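(* Let $a,b \in \mathbb{Z}[i]\setminus\{0\}$ have Gauss quotient $q$ and non-zero Gauss remainder $r$, and suppose $\phi_{\mathbb{Z}[i]}(r) \geq \phi_{\mathbb{Z}[i]}(b) = n$. If any of the following conditions hold: (1) $\Im(u_b b)\,\Im(u_r r) \geq 0$; (2) $m(r) + m(b) \leq \ell_\infty(r)$; (3) $m(b) < \ell_\infty(r) < m(b) + m(r)$ and $\ell_\infty(b) - m(r) > w_{n-1} - 2^{v_2(b)+1}$, then $a = \left(q + \frac{u_b}{u_r}\right) b + \left(r - \frac{u_b}{u_r} b\right)$ with $\phi_{\mathbb{Z}[i]}\left(r - \frac{u_b}{u_r} b\right) < \phi_{\mathbb{Z}[i]}(b)$. Otherwise, $a = \left(q + \frac{i u_b}{s(r) u_r}\right) b + \left(r - \frac{i u_b}{s(r) u_r} b\right)$ with $\phi_{\mathbb{Z}[i]}\left(r - \frac{i u_b}{s(r) u_r} b\right) < \phi_{\mathbb{Z}[i]}(b)$.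
   Context: $\mathbb{Z}[i]=\{x+yi : x,y\in\mathbb{Z}\}$ with units $\pm1,\pm i$ and norm $\mathrm{Nm}(x+yi)=x^2+y^2$. A function $f:\mathbb{Z}[i]\setminus\{0\}\to W$ ($W$ a well-ordered set having $\mathbb{N}$ as an initial segment) is Euclidean if for all nonzero $a,b$ there exist $q,r$ with $a=qb+r$ and either $r=0$ or $f(r)<f(b)$. $\phi_{\mathbb{Z}[i]}$ denotes the minimal Euclidean function, the pointwise minimum of all Euclidean functions on $\mathbb{Z}[i]\setminus\{0\}$ (itself Euclidean; equivalently, $\phi_{\mathbb{Z}[i]}(z)$ is the minimal $n$ such that $z=\sum_{j=0}^n u_j(1+i)^j$ with $u_j\in\{0,\pm1,\pm i\}$, $u_n\neq 0$). Gauss quotient/remainder: for nonzero $a,b$, write $a\bar b/\mathrm{Nm}(b)=\alpha+\beta i$ with $\alpha,\beta\in\mathbb{Q}$; let $\lfloor x\rceil=\lfloor x\rfloor$ if $0\le x-\lfloor x\rfloor\le 1/2$ and $\lceil x\rceil$ otherwise; the Gauss quotient is $q=\lfloor\alpha\rceil+\lfloor\beta\rceil i$ and the Gauss remainder is $r=a-qb$. For $z=x+yi$: $\ell_1(z)=|x|+|y|$, $\ell_\infty(z)=\max(|x|,|y|)$, $m(z)=\min(|x|,|y|)$. For $z\neq 0$, $u_z$ is the unique unit with $\Re(u_z z)=\ell_\infty(z)$ if $\ell_\infty(z)\neq m(z)$, and the unique unit with $u_z z=\ell_\infty(z)(1+i)$ if $\ell_\infty(z)=m(z)$. $s(r)=\mathrm{sgn}(\Im(u_r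 r))$ with $\mathrm{sgn}$ the usual sign function ($\mathrm{sgn}(0)=0$). $v_2(z)$ is the largest $j$ with $2^j\mid z$ in $\mathbb{Z}[i]$ (equivalently the 2-adic valuation of $\gcd(\Re z,\Im z)$). For integers $k$, $w_{2k}=3\cdot 2^k$ and $w_{2k+1}=4\cdot 2^k$ (so $w_0=3,w_1=4,w_2=6,w_3=8,\dots$). *)

theory Defs
  imports "HOL-Analysis.Analysis"
begin

definition gauss_ints :: "complex set" where
  "gauss_ints = {z. Re z \<in> \<int> \<and> Im z \<in> \<int>}"

definition gauss_units :: "complex set" where
  "gauss_units = {1, -1, \<i>, -\<i>}"

definition Nm :: "complex \<Rightarrow> real" where
  "Nm z = (Re z)\<^sup>2 + (Im z)\<^sup>2"


text \<open>Functions on the nonzero Gaussian integers are total functions on \<^typ>\<open>complex\<close> of which only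
  the values on \<^term>\<open>gauss_ints - {0}\<close> are constrained.\<close>

definition euclidean_fun :: "(complex \<Rightarrow> 'w::wellorder) \<Rightarrow> bool" where
  "euclidean_fun f \<longleftrightarrow>
     (\<forall>a \<in> gauss_ints - {0}. \<forall>b \<in> gauss_ints - {0}.
        \<exists>q \<in> gauss_ints. \<exists>r \<in> gauss_ints. a = q * b + r \<and> (r = 0 \<or> f r < f b))"

text \<open>The pointwise minimum is taken over the functions with values in \<^typ>\<open>nat\<close>; that it also lies
  below every Euclidean function into a well-order extending \<^typ>\<open>nat\<close> is \<open>min_euclid_least\<close>.\<close>

definition min_euclid :: "complex \<Rightarrow> nat" where
  "min_euclid z = (LEAST n. \<exists>f :: complex \<Rightarrow> nat. euclidean_fun f \<and> f z = n)"


definition gauss_round :: "real \<Rightarrow> int" where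
  "gauss_round x = (if 0 \<le> x - of_int \<lfloor>x\<rfloor> \<and> x - of_int \<lfloor>x\<rfloor> \<le> 1 / 2 then \<lfloor>x\<rfloor> else \<lceil>x\<rceil>)"

definition gauss_quot :: "complex \<Rightarrow> complex \<Rightarrow> complex" where
  "gauss_quot a b = (let t = a * cnj b / of_real (Nm b)
     in Complex (of_int (gauss_round (Re t))) (of_int (gauss_round (Im t))))"

definition gauss_rem :: "complex \<Rightarrow> complex \<Rightarrow> complex" where
  "gauss_rem a b = a - gauss_quot a b * b"


definition linf :: "complex \<Rightarrow> real" where
  "linf z = max \<bar>Re z\<bar> \<bar>Im z\<bar>"

definition lmin :: "complex \<Rightarrow> real" where
  "lmin z = min \<bar>Re z\<bar> \<bar>Im z\<bar>"

definition is_unit_of :: "complex \<Rightarrow> complex \<Rightarrow> bool" where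
  "is_unit_of z u \<longleftrightarrow> u \<in> gauss_units \<and>
     (if linf z \<noteq> lmin z then Re (u * z) = linf z
      else u * z = of_real (linf z) * (1 + \<i>))"

definition unit_of :: "complex \<Rightarrow> complex" where
  "unit_of z = (THE u. is_unit_of z u)"

definition s_sign :: "complex \<Rightarrow> real" where
  "s_sign r = sgn (Im (unit_of r * r))"

definition v2 :: "complex \<Rightarrow> nat" where
  "v2 z = Max {j. \<exists>c \<in> gauss_ints. z = 2 ^ j * c}"

text \<open>The index is an integer: \<open>w_seq (2 * k) = 3 * 2 powi k\<close> and \<open>w_seq (2 * k + 1) = 4 * 2 powi k\<close>, also
  for negative \<open>k\<close>, since \<open>div\<close> rounds down.\<close>

definition w_seq :: "int \<Rightarrow> real" where
  "w_seq k = (if even k then 3 else 4) * 2 powi (k div 2)"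


subsection \<open>The definitions are meaningful\<close>

lemma gauss_ints_closed:
  assumes "x \<in> gauss_ints" "y \<in> gauss_ints"
  shows "x + y \<in> gauss_ints" "x - y \<in> gauss_ints" "x * y \<in> gauss_ints" "cnj x \<in> gauss_ints"
  using assms by (auto simp: gauss_ints_def)

lemma Nm_mult: "Nm (x * y) = Nm x * Nm y"
  by (simp add: Nm_def algebra_simps power2_eq_square)

lemma gauss_round_close: "\<bar>x - of_int (gauss_round x)\<bar> \<le> 1 / 2"
proof (cases "0 \<le> x - of_int \<lfloor>x\<rfloor> \<and> x - of_int \<lfloor>x\<rfloor> \<le> 1 / 2")
  case True
  thus ?thesis by (simp add: gauss_round_def)
next
  case False
  hence "x - of_int \<lfloor>x\<rfloor> > 1 / 2" using of_int_floor_le[of x] by linarith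
  moreover have "\<lceil>x\<rceil> \<le> \<lfloor>x\<rfloor> + 1" by linarith
  hence "(of_int \<lceil>x\<rceil> :: real) \<le> of_int \<lfloor>x\<rfloor> + 1" by linarith
  moreover have "x \<le> of_int \<lceil>x\<rceil>" by (rule le_of_int_ceiling)
  ultimately have "\<bar>x - of_int \<lceil>x\<rceil>\<bar> \<le> 1 / 2" by linarith
  thus ?thesis using False unfolding gauss_round_def by (subst if_not_P) auto
qed

lemma Nm_gauss_rem:
  assumes "b \<noteq> 0"
  shows "Nm (gauss_rem a b) \<le> Nm b / 2"
proof -
  define t where "t = a * cnj b / of_real (Nm b)"
  have nb: "Nm b > 0" using assms
    by (metis Nm_def cmod_power2 zero_less_norm_iff zero_less_power)
  have "cnj b * b = of_real (Nm b)"
    by (simp add: complex_eq_iff Nm_def power2_eq_square)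
  hence a: "a = t * b" using nb by (simp add: t_def mult.assoc)
  have "gauss_rem a b = (t - gauss_quot a b) * b"
    unfolding gauss_rem_def by (subst a) (simp add: algebra_simps)
  hence N: "Nm (gauss_rem a b) = Nm (t - gauss_quot a b) * Nm b"
    by (simp add: Nm_mult)
  have sq: "d\<^sup>2 \<le> 1 / 4" if "\<bar>d\<bar> \<le> 1 / 2" for d :: real
    using power_mono[OF that, of 2] by (simp add: power2_eq_square)
  have "gauss_quot a b = Complex (of_int (gauss_round (Re t))) (of_int (gauss_round (Im t)))"
    by (simp only: gauss_quot_def Let_def t_def)
  hence "Nm (t - gauss_quot a b) \<le> 1 / 2"
    using sq[OF gauss_round_close[of "Re t"]] sq[OF gauss_round_close[of "Im t"]]
    by (simp add: Nm_def)
  thus ?thesis using N nb mult_right_mono[of "Nm (t - gauss_quot a b)" "1/2" "Nm b"] by simp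
qed

lemma euclidean_fun_Nm: "euclidean_fun (\<lambda>z. nat \<lfloor>Nm z\<rfloor>)"
  unfolding euclidean_fun_def
proof (intro ballI)
  fix a b assume a: "a \<in> gauss_ints - {0}" and b: "b \<in> gauss_ints - {0}"
  have q: "gauss_quot a b \<in> gauss_ints"
    by (simp add: gauss_quot_def gauss_ints_def Let_def)
  have r: "gauss_rem a b \<in> gauss_ints"
    using a b q unfolding gauss_rem_def by (auto intro: gauss_ints_closed)
  have "Nm b \<in> \<int>" using b by (auto simp: Nm_def gauss_ints_def)
  then obtain k where k: "Nm b = of_int k" by (auto elim: Ints_cases)
  have "Nm b > 0" using b
    by (metis Diff_iff Nm_def cmod_power2 insertI1 zero_less_norm_iff zero_less_power)
  hence "nat \<lfloor>Nm (gauss_rem a b)\<rfloor> < nat \<lfloor>Nm b\<rfloor>"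
    using Nm_gauss_rem[of b a] b k by (simp add: nat_less_iff floor_less_iff)
  thus "\<exists>q\<in>gauss_ints. \<exists>r\<in>gauss_ints. a = q * b + r \<and>
          (r = 0 \<or> nat \<lfloor>Nm r\<rfloor> < nat \<lfloor>Nm b\<rfloor>)"
    using q r by (intro bexI[of _ "gauss_quot a b"] bexI[of _ "gauss_rem a b"])
      (auto simp: gauss_rem_def)
qed

lemma min_euclid_attained:
  "\<exists>f :: complex \<Rightarrow> nat. euclidean_fun f \<and> f z = min_euclid z"
  unfolding min_euclid_def by (rule LeastI_ex) (use euclidean_fun_Nm in blast)

lemma min_euclid_le: "euclidean_fun f \<Longrightarrow> min_euclid z \<le> f z"
  unfolding min_euclid_def by (rule Least_le) blast

theorem euclidean_fun_min_euclid: "euclidean_fun min_euclid"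
  unfolding euclidean_fun_def
proof (intro ballI)
  fix a b assume a: "a \<in> gauss_ints - {0}" and b: "b \<in> gauss_ints - {0}"
  obtain f :: "complex \<Rightarrow> nat" where f: "euclidean_fun f" "f b = min_euclid b"
    using min_euclid_attained by blast
  then obtain q r where "q \<in> gauss_ints" "r \<in> gauss_ints" "a = q * b + r" "r = 0 \<or> f r < f b"
    using a b unfolding euclidean_fun_def by blast
  thus "\<exists>q\<in>gauss_ints. \<exists>r\<in>gauss_ints. a = q * b + r \<and> (r = 0 \<or> min_euclid r < min_euclid b)"
    using f min_euclid_le[OF f(1), of r] by (metis order_le_less_trans)
qed

theorem min_euclid_least:
  fixes f :: "complex \<Rightarrow> 'w::wellorder" and e :: "nat \<Rightarrow> 'w"
  assumes f: "euclidean_fun f"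
    and e: "strict_mono e" "\<And>x n. x < e n \<Longrightarrow> x \<in> range e"
  shows "e (min_euclid z) \<le> f z"
proof (rule ccontr)
  assume "\<not> ?thesis"
  hence less: "f z < e (min_euclid z)" by simp
  define g where "g z = (if f z < e (min_euclid z) then inv e (f z) else min_euclid z)" for z
  have inj: "inj e" using e(1) by (rule strict_mono_imp_inj_on)
  have eg: "e (g z) = min (f z) (e (min_euclid z))" for z
    using e(2)[of "f z"] by (auto simp: g_def min_def f_inv_into_f)
  have "euclidean_fun g"
    unfolding euclidean_fun_def
  proof (intro ballI)
    fix a b assume ab: "a \<in> gauss_ints - {0}" "b \<in> gauss_ints - {0}"
    have *: "g r < g b \<longleftrightarrow> e (g r) < e (g b)" for r
      using e(1) by (simp add: strict_mono_less)
    show "\<exists>q\<in>gauss_ints. \<exists>r\<in>gauss_ints. a = q * b + r \<and> (r = 0 \<or> g r < g b)"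
    proof (cases "f b < e (min_euclid b)")
      case True
      obtain q r where "q \<in> gauss_ints" "r \<in> gauss_ints" "a = q * b + r" "r = 0 \<or> f r < f b"
        using f ab unfolding euclidean_fun_def by blast
      thus ?thesis using True unfolding * eg by (metis min.strict_coboundedI1 min.absorb3)
    next
      case False
      obtain q r where "q \<in> gauss_ints" "r \<in> gauss_ints" "a = q * b + r"
          "r = 0 \<or> min_euclid r < min_euclid b"
        using euclidean_fun_min_euclid ab unfolding euclidean_fun_def by blast
      moreover have "e (min_euclid r) < e (min_euclid b)" if "min_euclid r < min_euclid b"
        using that e(1) by (simp add: strict_mono_less)
      ultimately show ?thesis using False unfolding * eg
        by (metis min.strict_coboundedI2 min.absorb2 not_less)
    qed
  qed
  hence "e (min_euclid z) \<le> e (g z)"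
    using min_euclid_le e(1) by (simp add: strict_mono_less_eq)
  thus False using less by (simp add: eg)
qed

lemma unit_of_unique:
  assumes "z \<noteq> 0"
  shows "\<exists>!u. is_unit_of z u"
proof -
  define x y where "x = Re z" and "y = Im z"
  have xy: "x \<noteq> 0 \<or> y \<noteq> 0" using assms by (simp add: complex_eq_iff x_def y_def)
  define L where "L = max \<bar>x\<bar> \<bar>y\<bar>"
  have L: "linf z = L" "linf z = lmin z \<longleftrightarrow> \<bar>x\<bar> = \<bar>y\<bar>"
    by (auto simp: linf_def lmin_def L_def x_def y_def)
  have units: "is_unit_of z 1 \<longleftrightarrow> x = L \<and> (x = y \<or> x = -y \<longrightarrow> y = L)"
    "is_unit_of z (-1) \<longleftrightarrow> -x = L \<and> (x = y \<or> x = -y \<longrightarrow> -y = L)"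
    "is_unit_of z \<i> \<longleftrightarrow> -y = L \<and> (x = y \<or> x = -y \<longrightarrow> x = L)"
    "is_unit_of z (-\<i>) \<longleftrightarrow> y = L \<and> (x = y \<or> x = -y \<longrightarrow> -x = L)"
    unfolding is_unit_of_def L(2) abs_eq_iff unfolding L(1)
    by (auto simp add: gauss_units_def complex_eq_iff simp flip: x_def y_def)
  have pos: "L > 0" and cases: "L = x \<or> L = -x \<or> L = y \<or> L = -y"
    using xy unfolding L_def by linarith+
  have only: "is_unit_of z u \<Longrightarrow> u = 1 \<or> u = -1 \<or> u = \<i> \<or> u = -\<i>" for u
    by (auto simp: is_unit_of_def gauss_units_def)
  have "is_unit_of z 1 \<or> is_unit_of z (-1) \<or> is_unit_of z \<i> \<or> is_unit_of z (-\<i>)"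
    unfolding units using cases by auto
  moreover have "\<not> (is_unit_of z 1 \<and> is_unit_of z (-1))" "\<not> (is_unit_of z 1 \<and> is_unit_of z \<i>)"
    "\<not> (is_unit_of z 1 \<and> is_unit_of z (-\<i>))" "\<not> (is_unit_of z (-1) \<and> is_unit_of z \<i>)"
    "\<not> (is_unit_of z (-1) \<and> is_unit_of z (-\<i>))" "\<not> (is_unit_of z \<i> \<and> is_unit_of z (-\<i>))"
    unfolding units using pos by auto
  ultimately show ?thesis using only by (elim disjE) metis+
qed

lemma is_unit_of_unit_of: "z \<noteq> 0 \<Longrightarrow> is_unit_of z (unit_of z)"
  unfolding unit_of_def by (rule theI') (rule unit_of_unique)

lemma v2_set_finite:
  assumes "z \<in> gauss_ints" "z \<noteq> 0"
  shows "finite {j :: nat. \<exists>c \<in> gauss_ints. z = 2 ^ j * c}" (is "finite ?S")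
    and "0 \<in> {j :: nat. \<exists>c \<in> gauss_ints. z = 2 ^ j * c}"
proof -
  have "real j \<le> cmod z" if "j \<in> ?S" for j
  proof -
    from that obtain c where c: "c \<in> gauss_ints" "z = 2 ^ j * c" by auto
    have "Re c \<noteq> 0 \<or> Im c \<noteq> 0" using c assms(2) by (auto simp: complex_eq_iff)
    hence "\<bar>Re c\<bar> \<ge> 1 \<or> \<bar>Im c\<bar> \<ge> 1"
      using c(1) Ints_nonzero_abs_ge1 by (auto simp: gauss_ints_def)
    hence "cmod c \<ge> 1"
      using abs_Re_le_cmod[of c] abs_Im_le_cmod[of c] by linarith
    moreover have "real j \<le> 2 ^ j" by (rule of_nat_less_two_power[THEN less_imp_le])
    moreover have "cmod z = 2 ^ j * cmod c" by (simp add: c(2) norm_mult norm_power)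
    moreover have "2 ^ j * 1 \<le> 2 ^ j * cmod c"
      using \<open>cmod c \<ge> 1\<close> by (intro mult_left_mono) auto
    ultimately show ?thesis by linarith
  qed
  hence "?S \<subseteq> {.. nat \<lfloor>cmod z\<rfloor>}" by (auto simp: le_nat_floor)
  thus "finite ?S" using finite_subset by blast
  show "0 \<in> ?S" using assms by simp
qed

lemma w_seq_even: "w_seq (2 * k) = 3 * 2 powi k" and w_seq_odd: "w_seq (2 * k + 1) = 4 * 2 powi k"
  by (simp_all add: w_seq_def)

end

theory Submission
  imports Defs
begin

text \<open>
  The level sets of the minimal Euclidean function are explicit: \<open>\<phi>(z) \<le> n\<close> iff \<open>z = 2\<^sup>s z'\<close> with
  \<open>z'\<close> not divisible by 2, \<open>2 s \<le> n\<close> and \<open>z'\<close> in the octagon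
  \<open>\<ell>\<^sub>\<infinity> \<le> w\<^sub>k - 2\<close>, \<open>\<ell>\<^sub>1 \<le> w\<^sub>k\<^sub>+\<^sub>1 - 3\<close>, where \<open>k = n - 2 s\<close>.

  Write \<open>b = (B, c)\<close> and \<open>r = (R, S)\<close> in absolute values, normalised to \<open>B \<ge> c\<close> and \<open>R \<ge> S\<close>. A Gauss
  remainder lies in the square spanned by \<open>b\<close>, so \<open>2 R \<le> B + c\<close> and \<open>R + S \<le> B\<close>. If \<open>r\<close> is not at a
  lower level than \<open>b\<close>, these bounds are so tight that \<open>r\<close> is divisible by a higher power \<open>T\<close> of 2 than
  \<open>b\<close> (after scaling, \<open>b\<close> is not divisible by 2), and that \<open>r\<close> lies within \<open>T\<close> or \<open>2 T\<close> of the real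
  octagon. Then \<open>r - u b\<close> is not divisible by 2 for any unit \<open>u\<close>, so only the octagon inequalities
  remain to be checked, and these are linear. In particular the level function is Euclidean, hence
  an upper bound for \<open>\<phi>\<close>.

  For the lower bound, suppose that every class modulo \<open>z\<close> has a representative which is 0 or of level
  below \<open>n\<close>. A factor \<open>1 + \<i>\<close> of \<open>z\<close> can be cancelled, lowering \<open>n\<close> by one. If \<open>z\<close> is prime to \<open>1 + \<i>\<close>,
  the class of \<open>(1 + \<i>) (z + 1) / 2\<close>, a deep hole of the lattice \<open>z \<int>[\<i>]\<close>, forces \<open>z\<close> into the octagon of
  level \<open>n\<close>.
\<close>

subsection \<open>Octagons and levels\<close>

text \<open>The sequence \<open>w_seq\<close> at natural indices, as integers, so that octagon
  membership is linear integer arithmetic; \<open>w_seq_eq_w\<close> leads back.\<close>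

definition w :: "nat \<Rightarrow> int" where
  "w n = (if even n then 3 else 4) * 2 ^ (n div 2)"

definition octagon :: "nat \<Rightarrow> int \<Rightarrow> int \<Rightarrow> bool" where
  "octagon n x y \<longleftrightarrow> \<bar>x\<bar> \<le> w n - 2 \<and> \<bar>y\<bar> \<le> w n - 2 \<and> \<bar>x\<bar> + \<bar>y\<bar> \<le> w (Suc n) - 3"

text \<open>Since \<open>x'\<close> and \<open>y'\<close> are not both even, \<open>s\<close> is the
  2-adic valuation of the point, and the origin lies in no level. A zero remainder is therefore
  always treated apart.\<close>

definition in_level :: "nat \<Rightarrow> int \<Rightarrow> int \<Rightarrow> bool" where
  "in_level n x y \<longleftrightarrow> (\<exists>s x' y'. x = 2 ^ s * x' \<and> y = 2 ^ s * y' \<and> (odd x' \<or> odd y')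
     \<and> 2 * s \<le> n \<and> octagon (n - 2 * s) x' y')"

lemma w_simps [simp]: "w 0 = 3" "w (Suc 0) = 4" "w (Suc (Suc n)) = 2 * w n"
  by (auto simp: w_def)

lemma w_add_double: "w (n + 2 * s) = 2 ^ s * w n"
  by (induction s) auto

text \<open>The relation between \<open>w n\<close> and \<open>w (Suc n)\<close> depends on the
  parity of \<open>n\<close>; with a common scale \<open>K\<close> either case is linear.\<close>

lemma w_shape:
  obtains K where "1 \<le> K" "w n = 3 * K \<and> w (Suc n) = 4 * K \<or> w n = 4 * K \<and> w (Suc n) = 6 * K"
proof (cases "even n")
  case True
  then show ?thesis by (intro that[of "2 ^ (n div 2)"]) (auto simp: w_def)
next
  case False
  then show ?thesis by (intro that[of "2 ^ (n div 2)"]) (auto simp: w_def)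
qed

lemma even_w_Suc: "even (w (Suc n))"
  using w_shape[of n] by (metis dvd_triv_left even_mult_iff even_numeral)

lemma w_ge: "3 \<le> w n"
  by (rule w_shape[of n]) auto

lemma w_mono: "m \<le> n \<Longrightarrow> w m \<le> w n"
proof (rule lift_Suc_mono_le[of w])
  show "w n \<le> w (Suc n)" for n by (rule w_shape[of n]) auto
qed

lemma octagon_mono: "octagon m x y \<Longrightarrow> m \<le> n \<Longrightarrow> octagon n x y"
  using w_mono[of m n] w_mono[of "Suc m" "Suc n"] by (auto simp: octagon_def)

lemma in_level_mono: "in_level m x y \<Longrightarrow> m \<le> n \<Longrightarrow> in_level n x y"
  unfolding in_level_def using octagon_mono diff_le_mono le_trans by blast

lemma power2_factor_unique:
  fixes x y x' y' :: int
  assumes "odd x \<or> odd y" "odd x' \<or> odd y'" "2 ^ s * x = 2 ^ t * x'" "2 ^ s * y = 2 ^ t * y'"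
  shows "s = t \<and> x = x' \<and> y = y'"
proof -
  have *: "\<not> s < t"
    if "odd x \<or> odd y" "2 ^ s * x = 2 ^ t * x'" "2 ^ s * y = 2 ^ t * y'"
    for x y x' y' :: int and s t
  proof
    assume "s < t"
    then obtain k where "t = s + Suc k" using less_imp_Suc_add by auto
    then have "x = 2 * (2 ^ k * x')" "y = 2 * (2 ^ k * y')" using that by (auto simp: power_add)
    then show False using that(1) by auto
  qed
  have "s = t" using *[of x y s t x' y'] *[of x' y' t s x y] assms by force
  then show ?thesis using assms by auto
qed

lemma power2_factor_exists:
  fixes x y :: int
  assumes "x \<noteq> 0 \<or> y \<noteq> 0"
  obtains s x' y' where "x = 2 ^ s * x'" "y = 2 ^ s * y'" "odd x' \<or> odd y'"
  using assms
proof (induction "nat (\<bar>x\<bar> + \<bar>y\<bar>)" arbitrary: x y thesis rule: less_induct)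
  case less
  show ?case
  proof (cases "odd x \<or> odd y")
    case True
    then show ?thesis using less(2)[of 0 x y] by auto
  next
    case False
    then obtain x1 y1 where xy: "x = 2 * x1" "y = 2 * y1" by (auto elim!: evenE)
    then have "nat (\<bar>x1\<bar> + \<bar>y1\<bar>) < nat (\<bar>x\<bar> + \<bar>y\<bar>)" "x1 \<noteq> 0 \<or> y1 \<noteq> 0" using less(3) by auto
    then obtain s x' y' where "x1 = 2 ^ s * x'" "y1 = 2 ^ s * y'" "odd x' \<or> odd y'"
      using less(1) by metis
    then show ?thesis using xy less(2)[of "Suc s" x' y'] by auto
  qed
qed

lemma in_level_iff:
  assumes "odd x \<or> odd y"
  shows "in_level n (2 ^ s * x) (2 ^ s * y) \<longleftrightarrow> 2 * s \<le> n \<and> octagon (n - 2 * s) x y"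
proof
  assume "in_level n (2 ^ s * x) (2 ^ s * y)"
  then obtain t x' y' where t: "2 ^ s * x = 2 ^ t * x'" "2 ^ s * y = 2 ^ t * y'" "odd x' \<or> odd y'"
     "2 * t \<le> n" "octagon (n - 2 * t) x' y'" unfolding in_level_def by blast
  then show "2 * s \<le> n \<and> octagon (n - 2 * s) x y"
    using power2_factor_unique[OF assms t(3,1,2)] by auto
qed (use assms in_level_def in blast)

lemma in_level_odd: "odd x \<or> odd y \<Longrightarrow> in_level n x y \<longleftrightarrow> octagon n x y"
  using in_level_iff[of x y n 0] by simp

lemma in_level_scale: "in_level (n + 2 * s) (2 ^ s * x) (2 ^ s * y) \<longleftrightarrow> in_level n x y"
proof (cases "x = 0 \<and> y = 0")
  case True
  then show ?thesis by (auto simp: in_level_def)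
next
  case False
  then obtain t x' y' where t: "x = 2 ^ t * x'" "y = 2 ^ t * y'" "odd x' \<or> odd y'"
    using power2_factor_exists by metis
  have e: "2 ^ s * x = 2 ^ (t + s) * x'" "2 ^ s * y = 2 ^ (t + s) * y'"
    unfolding t(1,2) by (simp_all add: power_add)
  have "in_level (n + 2 * s) (2 ^ s * x) (2 ^ s * y) \<longleftrightarrow> 2 * t \<le> n \<and> octagon (n - 2 * t) x' y'"
    unfolding e in_level_iff[OF t(3)] by simp
  then show ?thesis unfolding t(1,2) in_level_iff[OF t(3)] .
qed

lemma in_level_abs:
  assumes "\<bar>x\<bar> = \<bar>x'\<bar>" "\<bar>y\<bar> = \<bar>y'\<bar>" "in_level n x y"
  shows "in_level n x' y'"
proof -
  obtain s u v where s: "x = 2 ^ s * u" "y = 2 ^ s * v" "odd u \<or> odd v"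
     "2 * s \<le> n" "octagon (n - 2 * s) u v" using assms(3) unfolding in_level_def by blast
  obtain u' where u: "x' = 2 ^ s * u'" "\<bar>u'\<bar> = \<bar>u\<bar>"
    using assms(1) s(1) that[of u] that[of "-u"] by (metis abs_eq_iff abs_minus mult_minus_right)
  obtain v' where v: "y' = 2 ^ s * v'" "\<bar>v'\<bar> = \<bar>v\<bar>"
    using assms(2) s(2) that[of v] that[of "-v"] by (metis abs_eq_iff abs_minus mult_minus_right)
  have "odd u' \<or> odd v'" using s(3) u(2) v(2) by (metis dvd_abs_iff)
  moreover have "octagon (n - 2 * s) u' v'" using s(5) u v by (simp add: octagon_def)
  ultimately show ?thesis using s(4) u v unfolding in_level_def by blast
qed

lemma in_level_swap: "in_level n x y \<longleftrightarrow> in_level n y x"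
  unfolding in_level_def octagon_def by (auto simp: ac_simps; metis add.commute)

text \<open>Scaling widens the margins: \<open>2 ^ s\<close> times the bounds of index
  \<open>n - 2 * s\<close> are \<open>w n - 2 * 2 ^ s\<close> and
  \<open>w (Suc n) - 3 * 2 ^ s\<close>, which are at least as strict as those of index
  \<open>n\<close>.\<close>

lemma in_level_octagon:
  assumes "in_level n x y"
  shows "octagon n x y"
proof -
  obtain s u v where s: "x = 2 ^ s * u" "y = 2 ^ s * v"
     "2 * s \<le> n" "octagon (n - 2 * s) u v" using assms unfolding in_level_def by blast
  define j P where "j = n - 2 * s" and "P = (2::int) ^ s"
  have w: "w n = P * w j" "w (Suc n) = P * w (Suc j)"
    using w_add_double[of j s] w_add_double[of "Suc j" s] s(3) by (auto simp: j_def P_def)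
  have P: "1 \<le> P" by (simp add: P_def)
  then have "P * \<bar>u\<bar> \<le> P * (w j - 2)" "P * \<bar>v\<bar> \<le> P * (w j - 2)"
    "P * (\<bar>u\<bar> + \<bar>v\<bar>) \<le> P * (w (Suc j) - 3)"
    using s(4) by (auto simp: octagon_def j_def)
  then have "P * \<bar>u\<bar> \<le> w n - 2 * P" "P * \<bar>v\<bar> \<le> w n - 2 * P"
    "P * \<bar>u\<bar> + P * \<bar>v\<bar> \<le> w (Suc n) - 3 * P"
    unfolding w by (simp_all add: distrib_left right_diff_distrib mult.commute)
  moreover have "\<bar>x\<bar> = P * \<bar>u\<bar>" "\<bar>y\<bar> = P * \<bar>v\<bar>" by (simp_all add: s(1,2) P_def abs_mult)
  ultimately show ?thesis using P unfolding octagon_def by linarith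
qed

lemma in_level_exists:
  assumes "x \<noteq> 0 \<or> y \<noteq> 0" shows "\<exists>n. in_level n x y"
proof -
  obtain s x' y' where t: "x = 2 ^ s * x'" "y = 2 ^ s * y'" "odd x' \<or> odd y'"
    using power2_factor_exists[OF assms] by metis
  define k where "k = nat (\<bar>x'\<bar> + \<bar>y'\<bar>)"
  have "int k < 2 ^ k" by (metis of_nat_less_two_power)
  moreover have "w (2 * k) = 2 ^ k * 3" "w (Suc (2 * k)) = 2 ^ k * 4"
    by (auto simp: w_def)
  moreover have "int k = \<bar>x'\<bar> + \<bar>y'\<bar>" unfolding k_def by simp
  ultimately have "octagon (2 * k) x' y'" unfolding octagon_def using t(3) by auto
  then have "in_level (2 * k + 2 * s) x y" using in_level_iff[OF t(3), of "2 * k + 2 * s" s] t by simp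
  then show ?thesis by blast
qed

subsection \<open>Remainders of maximal level\<close>

text \<open>The bounds on \<open>2 * R\<close> and \<open>R + S\<close> give \<open>R < w m\<close>
  and \<open>R + S < w (Suc m)\<close>, while failing level \<open>m\<close> pushes \<open>r\<close>
  close to one of these two lines. Let \<open>T = 2 ^ v\<close> be the exact power of 2 in
  \<open>r\<close>. Case \<open>large\<close> is \<open>2 * v <= m\<close>: there \<open>R\<close>,
  \<open>S\<close> and both values of \<open>w\<close> are multiples of \<open>T\<close>, whence the
  gaps of size \<open>T\<close> in the disjunctions. Case \<open>small\<close> is
  \<open>m < 2 * v\<close>: no point of valuation \<open>v\<close> has level \<open>m\<close>, and
  size alone leaves few candidates.\<close>

lemma remainder_shape:
  assumes b: "octagon (Suc m) B c" "odd B \<or> odd c" "0 \<le> c" "c \<le> B"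
    and r: "0 \<le> S" "S \<le> R" "0 < R" "2 * R \<le> B + c" "R + S \<le> B" "R + S = B \<longrightarrow> even (B + c)"
    and nr: "\<not> in_level m R S"
  obtains
    (large) T M where "even T" "2 \<le> T" "even R" "even S" "S = 0 \<or> T \<le> S" "T \<le> M"
      "w m = 3 * M \<and> w (Suc m) = 4 * M \<or> w m = 4 * M \<and> w (Suc m) = 6 * M" "M = T \<or> 2 * T \<le> M"
      "R = w m - T \<or> R \<le> w m - 2 * T"
      "R + S = w (Suc m) - T \<or> R + S = w (Suc m) - 2 * T \<or> R + S \<le> w (Suc m) - 3 * T"
      "R = w m - T \<or> R + S \<ge> w (Suc m) - 2 * T"
      "S \<ge> w (Suc m) - w m \<or> S \<le> w (Suc m) - w m - T"
  | (small) T where "even T" "2 \<le> T" "R = T"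
      "w m = 2 * T \<and> w (Suc m) = 3 * T \<and> (S = 0 \<or> S = T) \<or> 2 * w m = 3 * T \<and> w (Suc m) = 2 * T \<and> S = 0"
proof -
  obtain v R' S' where v: "R = 2 ^ v * R'" "S = 2 ^ v * S'" "odd R' \<or> odd S'"
    using power2_factor_exists[of R S] r(3) by (metis less_numeral_extra(3))
  define T :: int where "T = 2 ^ v"
  have T: "1 \<le> T" "R = T * R'" "S = T * S'" using v by (auto simp: T_def)
  have R': "1 \<le> R'" "0 \<le> S'" "S' \<le> R'"
    using T r(1,2,3) by (auto simp: zero_less_mult_iff zero_le_mult_iff)
  have b': "B \<le> w (Suc m) - 2" "B + c \<le> 2 * w m - 3" using b by (auto simp: octagon_def)
  have nv: "\<not> (2 * v \<le> m \<and> octagon (m - 2 * v) R' S')"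
    using nr v in_level_iff by metis
  show ?thesis
  proof (cases "2 * v \<le> m")
    case True
    define j where "j = m - 2 * v"
    have wj: "w m = T * w j" "w (Suc m) = T * w (Suc j)"
      using w_add_double[of j v] w_add_double[of "Suc j" v] True by (auto simp: j_def T_def)
    obtain K where K: "1 \<le> K" "w j = 3 * K \<and> w (Suc j) = 4 * K \<or> w j = 4 * K \<and> w (Suc j) = 6 * K"
      by (rule w_shape)
    have "T * R' < T * w j" "T * (R' + S') < T * w (Suc j)"
      unfolding distrib_left T(2,3)[symmetric] wj[symmetric] using r(4,5) b' by auto
    then have lt: "R' < w j" "R' + S' < w (Suc j)" using T(1) by auto
    have ge: "R' = w j - 1 \<or> R' + S' \<ge> w (Suc j) - 2"
      using nv True R' lt by (auto simp: octagon_def j_def)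
    \<comment> \<open>For \<open>T = 1\<close> the bound on \<open>2 * R\<close> excludes
      \<open>R = w m - 1\<close>, so \<open>R + S = B = w (Suc m) - 2\<close>. This number is even,
      and the tie condition makes \<open>c\<close> even too, against the oddness of
      \<open>b\<close>.\<close>
    have "T \<noteq> 1"
    proof
      assume T1: "T = 1"
      then have "R + S \<ge> w (Suc m) - 2" using ge T wj r(4) b' by auto
      then have "R + S = B" "B = w (Suc m) - 2" using b' r(5) by auto
      then show False using r(6) b(2) even_w_Suc[of m] by auto
    qed
    then have "v \<noteq> 0" by (auto simp: T_def)
    then have "even T" by (simp add: T_def)
    moreover from this have "2 \<le> T" using T(1) by presburger
    moreover have "even R" "even S" using T \<open>even T\<close> by auto
    moreover have "S = 0 \<or> T \<le> S" using T R' by (cases "S' = 0") auto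
    moreover have TM: "T \<le> T * K" using K T by auto
    moreover have "w m = 3 * (T * K) \<and> w (Suc m) = 4 * (T * K) \<or> w m = 4 * (T * K) \<and> w (Suc m) = 6 * (T * K)"
      using wj K by auto
    moreover have TK2: "T * K = T \<or> 2 * T \<le> T * K" using K T by (cases "K = 1") auto
    moreover have top: "R = w m - T" if "R' = w j - 1"
      unfolding T(2) wj(1) that by (simp add: right_diff_distrib)
    moreover have "R = w m - T \<or> R \<le> w m - 2 * T"
    proof (cases "R' = w j - 1")
      case False
      then have "T * R' \<le> T * (w j - 2)" using lt T by (intro mult_left_mono) auto
      then show ?thesis using T wj by (auto simp: algebra_simps)
    qed (use top in auto)
    moreover have "R + S = w (Suc m) - T \<or> R + S = w (Suc m) - 2 * T \<or> R + S \<le> w (Suc m) - 3 * T"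
    proof (cases "R' + S' = w (Suc j) - 1 \<or> R' + S' = w (Suc j) - 2")
      case True
      have "R + S = T * (R' + S')" using T by (auto simp: algebra_simps)
      then have "R + S = T * (w (Suc j) - 1) \<or> R + S = T * (w (Suc j) - 2)" using True by metis
      then show ?thesis unfolding wj by (auto simp: right_diff_distrib)
    next
      case False
      then have "T * (R' + S') \<le> T * (w (Suc j) - 3)" using lt T by (intro mult_left_mono) auto
      then show ?thesis using T wj by (auto simp: algebra_simps)
    qed
    moreover have "R = w m - T \<or> R + S \<ge> w (Suc m) - 2 * T"
      using ge
    proof
      assume "R' + S' \<ge> w (Suc j) - 2"
      then have "T * (R' + S') \<ge> T * (w (Suc j) - 2)" using T by (intro mult_left_mono) auto
      then show ?thesis using T wj by (auto simp: algebra_simps)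
    qed (use top in auto)
    moreover have "S \<ge> w (Suc m) - w m \<or> S \<le> w (Suc m) - w m - T"
    proof (cases "S' \<ge> w (Suc j) - w j")
      case True
      then have "T * S' \<ge> T * (w (Suc j) - w j)" using T by (intro mult_left_mono) auto
      then show ?thesis using T wj by (auto simp: algebra_simps)
    next
      case False
      then have "T * S' \<le> T * (w (Suc j) - w j - 1)" using T by (intro mult_left_mono) auto
      then show ?thesis using T wj by (auto simp: algebra_simps)
    qed
    ultimately show ?thesis using large[of T "T * K"] by blast
  next
    case False
    then obtain u where u: "v = Suc u" by (cases v) auto
    define Q :: int where "Q = 2 ^ u"
    have Q: "1 \<le> Q" "T = 2 * Q" by (auto simp: Q_def T_def u)
    have wQ: "w (2 * u) = 3 * Q" "w (Suc (2 * u)) = 4 * Q"  "w (Suc (Suc (2 * u))) = 6 * Q"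
      by (auto simp: w_def Q_def)
    have "T * 1 \<le> T * R'" using R' T by (intro mult_left_mono) auto
    then have TR: "T \<le> R" using T(2) by simp
    then have Tw: "T + 1 < w m" using r(4) b' by linarith
    \<comment> \<open>\<open>T <= R < w m\<close> bounds \<open>v = Suc u\<close> from above in
      terms of \<open>m\<close>. As also \<open>m < 2 * v\<close>, two values of \<open>m\<close>
      remain.\<close>
    have m: "m = 2 * u \<or> m = Suc (2 * u)"
    proof (rule ccontr)
      assume "\<not> ?thesis"
      then have "Suc (Suc m) \<le> Suc (2 * u)" using False u by auto
      then have "2 * w m \<le> 4 * Q" using w_mono[of "Suc (Suc m)" "Suc (2 * u)"] wQ by auto
      then show False using Tw Q by auto
    qed
    have "R < 2 * T" using m wQ r(4) b' Q by auto
    then have "R' = 1" using R' T by (cases "R' \<ge> 2") (auto dest: mult_left_mono[of 2 R' T])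
    then have RS: "R = T" "S = 0 \<or> S = T" using T R' by (auto simp: le_less int_one_le_iff_zero_less)
    moreover have "m = 2 * u \<Longrightarrow> S = 0" using RS r(5) b' wQ Q by auto
    ultimately show ?thesis using small[of T] Q wQ m by auto
  qed
qed



text \<open>The lower bounds for \<open>R\<close> and \<open>R + S\<close> ensure that a correction
  takes enough off the coordinates of \<open>b\<close>. The last two facts serve the correction by a
  quarter turn of \<open>b\<close> and the one with opposite signs of the imaginary parts,
  respectively.\<close>

lemma remainder_bounds:
  assumes b: "octagon (Suc m) B c" "odd B \<or> odd c" "0 \<le> c" "c \<le> B"
    and r: "0 \<le> S" "S \<le> R" "0 < R" "2 * R \<le> B + c" "R + S \<le> B" "R + S = B \<longrightarrow> even (B + c)"
    and nr: "\<not> in_level m R S"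
  shows "even R" "even S" "w (Suc m) - w m \<le> R" "2 * w m - w (Suc m) \<le> R + S"
    "0 < S \<Longrightarrow> R \<le> c \<Longrightarrow> B - S \<le> w m - 2"
    "0 < S \<Longrightarrow> w m - 1 \<le> B - S \<Longrightarrow> (B - R) + (c + S) \<le> w (Suc m) - 3"
proof -
  have b': "B \<le> w (Suc m) - 2" "B + c \<le> 2 * w m - 3" using b by (auto simp: octagon_def)
  have "even R \<and> even S \<and> w (Suc m) - w m \<le> R \<and> 2 * w m - w (Suc m) \<le> R + S
    \<and> (0 < S \<and> R \<le> c \<longrightarrow> B - S \<le> w m - 2)
    \<and> (0 < S \<and> w m - 1 \<le> B - S \<longrightarrow> (B - R) + (c + S) \<le> w (Suc m) - 3)"
  proof (rule remainder_shape[OF assms], goal_cases large small)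
    case (large T M)
    note T = large(1-6)
    note WA = large(7)
    have "w (Suc m) - w m \<le> R"
      using WA large(11) T(2,6) r(2) by (elim disjE conjE) linarith+
    moreover have "2 * w m - w (Suc m) \<le> R + S"
      using WA large(11) T(2,6) r(1) by (elim disjE conjE) linarith+
    moreover have "B - S \<le> w m - 2" if "0 < S" "R \<le> c"
    proof -
      have "T \<le> S" using that T by auto
      show ?thesis
        using large(11)
      proof
        assume "R = w m - T"
        then show ?thesis using \<open>T \<le> S\<close> that b' by linarith
      next
        \<comment> \<open>If \<open>w m = 3 * T\<close>, the bound on \<open>B\<close> and
          \<open>T <= S\<close> suffice. Otherwise \<open>R <= c\<close> gives
          \<open>B - S <= 2 * w m - 3 - (R + S)\<close>, which is small enough.\<close>
        assume "w (Suc m) - 2 * T \<le> R + S"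
        then show ?thesis using \<open>T \<le> S\<close> WA large(8) that b' T(2) r(2)
          by (elim disjE conjE) linarith+
      qed
    qed
    moreover have "(B - R) + (c + S) \<le> w (Suc m) - 3" if "0 < S" "w m - 1 \<le> B - S"
    proof -
      have "S \<le> w (Suc m) - w m - T" using large(12) that b' by linarith
      then show ?thesis using large(9,11) that b' T(2) by linarith
    qed
    ultimately show ?thesis using large(3,4) by blast
  next
    case (small T)
    show ?thesis
      using small(4)
      by (elim disjE conjE; intro conjI impI; insert small(1-3) b'; (linarith | simp))
  qed
  then show "even R" "even S" "w (Suc m) - w m \<le> R" "2 * w m - w (Suc m) \<le> R + S"
    "0 < S \<Longrightarrow> R \<le> c \<Longrightarrow> B - S \<le> w m - 2"
    "0 < S \<Longrightarrow> w m - 1 \<le> B - S \<Longrightarrow> (B - R) + (c + S) \<le> w (Suc m) - 3" by blast+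
qed

text \<open>Up to signs and order, these are the differences of \<open>r\<close> and a unit multiple
  of \<open>b\<close>: imaginary parts of equal sign, of opposite sign, and \<open>b\<close> given a
  quarter turn. As \<open>R\<close> and \<open>S\<close> are even and \<open>b\<close> is not
  divisible by 2, neither is any difference, so its level is decided by the octagon alone.\<close>

lemma remainder_core:
  assumes b: "octagon (Suc m) B c" "odd B \<or> odd c" "0 \<le> c" "c \<le> B"
    and r: "0 \<le> S" "S \<le> R" "0 < R" "2 * R \<le> B + c" "R + S \<le> B" "R + S = B \<longrightarrow> even (B + c)"
    and nr: "\<not> in_level m R S"
  shows "in_level m (B - R) (c - S)"
    and "0 < S \<Longrightarrow> S + c \<le> R \<or> w m - 2 < B - S \<Longrightarrow> in_level m (B - R) (c + S)"
    and "0 < S \<Longrightarrow> R < S + c \<Longrightarrow> R \<le> c \<or> B - S \<le> w m - 2 \<Longrightarrow> in_level m (R - c) (B - S)"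
proof -
  note R = remainder_bounds[OF assms]
  have b': "B \<le> w (Suc m) - 2" "B + c \<le> 2 * w m - 3" using b by (auto simp: octagon_def)
  have par: "odd (B - R) \<or> odd (c - S)" "odd (B - R) \<or> odd (c + S)" "odd (R - c) \<or> odd (B - S)"
    using R(1,2) b(2) by auto
  have evw: "even (w (Suc m))" by (rule even_w_Suc)
  have bd: "0 \<le> B - R" "B - R \<le> w m - 2" "c \<le> w m - 2" "R \<le> w m - 2" "S \<le> w m - 2" "0 \<le> B - S"
    using b(3,4) b' R(3) r by linarith+
  show "in_level m (B - R) (c - S)"
  proof -
    have "(B - R) + (c - S) \<le> w (Suc m) - 3" using b' R(4) by linarith
    \<comment> \<open>The left side reaches \<open>B\<close> only for \<open>R = S\<close> and
      \<open>c = 0\<close>. Then \<open>B\<close> is odd while \<open>w (Suc m)\<close> is even,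
      which gains the missing 1.\<close>
    moreover have "(B - R) + (S - c) \<le> w (Suc m) - 3"
    proof (cases "R = S \<and> c = 0")
      case True
      then have "B \<noteq> w (Suc m) - 2" using b(2) evw by auto
      then show ?thesis using b' True by linarith
    qed (use b' r(2) b(3) in linarith)
    ultimately show ?thesis
      unfolding in_level_odd[OF par(1)] octagon_def using bd b(3) r(1) by linarith
  qed
  show "in_level m (B - R) (c + S)" if S: "0 < S" and far: "S + c \<le> R \<or> w m - 2 < B - S"
  proof (cases "S + c \<le> R")
    case True
    \<comment> \<open>Both equalities together would make \<open>c = R - S\<close> and
      \<open>B\<close> even.\<close>
    have "\<not> (S + c = R \<and> B = w (Suc m) - 2)"
      using R(1,2) evw b(2) by auto
    then have "(B - R) + (c + S) \<le> w (Suc m) - 3" using True b' by linarith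
    then show ?thesis
      unfolding in_level_odd[OF par(2)] octagon_def using True bd b(3) r(1) by linarith
  next
    case False
    then have far: "w m - 1 \<le> B - S" using far by linarith
    then show ?thesis
      unfolding in_level_odd[OF par(2)] octagon_def using R(6)[OF S far] bd b(3) b' r(1) by linarith
  qed
  show "in_level m (R - c) (B - S)" if S: "0 < S" "R < S + c" and c: "R \<le> c \<or> B - S \<le> w m - 2"
  proof -
    have "B - S \<le> w m - 2" using R(5) S c by blast
    then show ?thesis
      unfolding in_level_odd[OF par(3)] octagon_def using bd b(3) b' r R(4) S(2) by linarith
  qed
qed

text \<open>Division by \<open>P\<close> reduces this to \<open>remainder_core\<close>. The
  hypothesis on \<open>R + S = P * B\<close> describes ties: such a Gauss remainder is a corner of
  its square unless \<open>B = c\<close>. After division it says that \<open>B + c\<close> is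
  even.\<close>

lemma remainder_level:
  fixes P :: int
  assumes P: "P = 2 ^ s"
    and b: "odd B \<or> odd c" "0 \<le> c" "c \<le> B" "in_level n (P * B) (P * c)"
    and r: "0 \<le> S" "S \<le> R" "0 < R" "2 * R \<le> P * B + P * c" "R + S \<le> P * B"
      "R + S = P * B \<longrightarrow> 2 * R = P * B + P * c \<or> 2 * R = P * B - P * c \<or> B = c"
    and nr: "n = 0 \<or> \<not> in_level (n - 1) R S"
  shows "0 < n"
    and "in_level (n - 1) (P * B - R) (P * c - S)"
    and "0 < S \<Longrightarrow> S + P * c \<le> R \<or> w (n - 1) - 2 * P < P * B - S
      \<Longrightarrow> in_level (n - 1) (P * B - R) (P * c + S)"
    and "0 < S \<Longrightarrow> R < S + P * c \<Longrightarrow> R \<le> P * c \<or> P * B - S \<le> w (n - 1) - 2 * P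
      \<Longrightarrow> in_level (n - 1) (R - P * c) (P * B - S)"
proof -
  have P1: "1 \<le> P" by (simp add: P)
  define k where "k = n - 2 * s"
  have n: "n = k + 2 * s" and oc: "octagon k B c"
    using b(4) in_level_iff[OF b(1)] by (auto simp: k_def P)
  obtain v R' S' where v: "R = 2 ^ v * R'" "S = 2 ^ v * S'" "odd R' \<or> odd S'"
    using power2_factor_exists[of R S] r(3) by (metis less_numeral_extra(3))
  \<comment> \<open>If \<open>r\<close> had fewer factors 2 than \<open>b\<close>, the octagon of
    \<open>b\<close> scaled by \<open>Q >= 2\<close> would have margins wide enough to put
    \<open>r\<close> into level \<open>n - 1\<close>.\<close>
  have "s \<le> v"
  proof (rule ccontr)
    assume "\<not> s \<le> v"
    then obtain d where d: "s = v + Suc d" using less_imp_Suc_add[of v s] by auto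
    define Q :: int where "Q = 2 ^ Suc d"
    have Q: "2 \<le> Q" "P = 2 ^ v * Q" by (simp_all add: Q_def P d power_add)
    define j where "j = k + 2 * d + 1"
    have nj: "n - 1 = j + 2 * v" "0 < n" using n d by (auto simp: j_def)
    have wj: "w (Suc j) = Q * w k" "2 * w j = Q * w (Suc k)"
      using w_add_double[of k "Suc d"] w_add_double[of "Suc k" "Suc d"] by (auto simp: j_def Q_def)
    have "2 ^ v * (2 * R') \<le> 2 ^ v * (Q * (B + c))" "2 ^ v * (R' + S') \<le> 2 ^ v * (Q * B)"
      using r(4,5) unfolding v(1,2) Q(2) by (simp_all add: algebra_simps)
    then have "2 * R' \<le> Q * (B + c)" "R' + S' \<le> Q * B" by simp_all
    moreover have "Q * (B + c) \<le> Q * (w (Suc k) - 3)" "Q * B \<le> Q * (w k - 2)"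
      using oc Q(1) by (auto simp: octagon_def intro!: mult_left_mono)
    ultimately have "R' \<le> w j - 3" "R' + S' \<le> w (Suc j) - 4"
      using Q(1) wj by (auto simp: right_diff_distrib)
    moreover have "0 \<le> R'" "0 \<le> S'" "S' \<le> R'" using r(1-3) v(1,2)
      by (auto simp: zero_less_mult_iff zero_le_mult_iff)
    ultimately have "octagon j R' S'" by (simp add: octagon_def)
    then have "in_level (n - 1) R S" unfolding nj(1) v(1,2) in_level_iff[OF v(3)] by simp
    then show False using nr nj by auto
  qed
  define R0 S0 where "R0 = 2 ^ (v - s) * R'" and "S0 = 2 ^ (v - s) * S'"
  have RS: "R = P * R0" "S = P * S0"
    using v \<open>s \<le> v\<close> by (simp_all add: R0_def S0_def P flip: power_add mult.assoc)
  have r0: "0 \<le> S0" "S0 \<le> R0" "0 < R0"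
    using r(1-3) P1 unfolding RS by (auto simp: zero_less_mult_iff zero_le_mult_iff)
  have "P * (2 * R0) \<le> P * (B + c)" "P * (R0 + S0) \<le> P * B"
    using r(4,5) unfolding RS by (simp_all add: algebra_simps)
  then have r0': "2 * R0 \<le> B + c" "R0 + S0 \<le> B" using P1 by simp_all
  have r0'': "R0 + S0 = B \<longrightarrow> even (B + c)"
  proof
    assume "R0 + S0 = B"
    then have "R + S = P * B" unfolding RS by (simp flip: distrib_left)
    then have "P * (2 * R0) = P * (B + c) \<or> P * (2 * R0) = P * (B - c) \<or> B = c"
      using r(6) unfolding RS by (simp add: algebra_simps)
    then have "2 * R0 = B + c \<or> 2 * R0 = B - c \<or> B = c" using P1 by auto
    then show "even (B + c)" by presburger
  qed
  \<comment> \<open>At index 0 the point \<open>(B, c)\<close> is \<open>(1, 0)\<close>, so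
    \<open>2 * R0 <= 1\<close> contradicts \<open>0 < R0\<close>.\<close>
  have "k \<noteq> 0"
  proof
    assume "k = 0"
    then show False using oc r0' r0 b(2,3) by (auto simp: octagon_def)
  qed
  then obtain m where m: "k = Suc m" by (cases k) auto
  have nm: "n - 1 = m + 2 * s" using n m by simp
  show "0 < n" using n m by simp
  have nr0: "\<not> in_level m R0 S0"
    using nr \<open>0 < n\<close> unfolding nm RS P in_level_scale by simp
  note core = remainder_core[OF oc[unfolded m] b(1-3) r0 r0' r0'' nr0]
  have wm: "w (n - 1) = P * w m" unfolding nm w_add_double P ..
  have scale: "in_level (n - 1) (P * x) (P * y) \<longleftrightarrow> in_level m x y" for x y
    unfolding nm P in_level_scale ..
  show "in_level (n - 1) (P * B - R) (P * c - S)"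
    using core(1) scale[of "B - R0" "c - S0"] unfolding RS by (simp add: right_diff_distrib)
  show "in_level (n - 1) (P * B - R) (P * c + S)"
    if S: "0 < S" and c: "S + P * c \<le> R \<or> w (n - 1) - 2 * P < P * B - S"
  proof -
    have "0 < S0" using S P1 unfolding RS by (simp add: zero_less_mult_iff)
    moreover have "P * (S0 + c) \<le> P * R0 \<or> P * (w m - 2) < P * (B - S0)"
      using c unfolding RS wm by (simp add: algebra_simps)
    then have "S0 + c \<le> R0 \<or> w m - 2 < B - S0" using P1 by simp
    ultimately show ?thesis
      using core(2) scale[of "B - R0" "c + S0"] unfolding RS
      by (simp add: right_diff_distrib distrib_left)
  qed
  show "in_level (n - 1) (R - P * c) (P * B - S)"
    if S: "0 < S" and c: "R < S + P * c" "R \<le> P * c \<or> P * B - S \<le> w (n - 1) - 2 * P"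
  proof -
    have "0 < S0" using S P1 unfolding RS by (simp add: zero_less_mult_iff)
    moreover have "P * R0 < P * (S0 + c)" "P * R0 \<le> P * c \<or> P * (B - S0) \<le> P * (w m - 2)"
      using c unfolding RS wm by (simp_all add: algebra_simps)
    then have "R0 < S0 + c" "R0 \<le> c \<or> B - S0 \<le> w m - 2" using P1 by simp_all
    ultimately show ?thesis
      using core(3) scale[of "R0 - c" "B - S0"] unfolding RS
      by (simp add: right_diff_distrib)
  qed
qed

subsection \<open>Geometry of the Gauss remainder\<close>

text \<open>Here t + u i is a rounding error and X + Y i its product with x + y i. The sum and the
  difference of \<open>X\<close> and \<open>Y\<close> are each a multiple of \<open>x + y\<close>
  plus a multiple of \<open>x - y\<close>, with factors at most 1/2 in absolute value, so they are
  at most \<open>x\<close>. Equality forces \<open>t\<close> and \<open>u\<close> to be 1/2 or -1/2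
  unless \<open>x + y\<close> or \<open>x - y\<close> vanishes, which means a corner of the
  square.\<close>

lemma half_square_bounds:
  fixes t u x y X Y :: real
  assumes t: "\<bar>t\<bar> \<le> 1 / 2" "\<bar>u\<bar> \<le> 1 / 2" and y: "\<bar>y\<bar> \<le> x"
    and X: "X = t * x - u * y" and Y: "Y = t * y + u * x"
  shows "2 * \<bar>X\<bar> \<le> x + \<bar>y\<bar>" "\<bar>X\<bar> + \<bar>Y\<bar> \<le> x"
    and "\<bar>X\<bar> + \<bar>Y\<bar> = x \<Longrightarrow> \<bar>y\<bar> \<noteq> x \<Longrightarrow> 2 * \<bar>X\<bar> = x + \<bar>y\<bar> \<or> 2 * \<bar>X\<bar> = x - \<bar>y\<bar>"
proof -
  have half: "- z \<le> 2 * (t * z)" "2 * (t * z) \<le> z" "- z \<le> 2 * (u * z)" "2 * (u * z) \<le> z"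
    if "0 \<le> z" for z
  proof -
    have "- 1 \<le> 2 * t" "2 * t \<le> 1" "- 1 \<le> 2 * u" "2 * u \<le> 1" using t by linarith+
    from this[THEN mult_right_mono, OF that]
    show "- z \<le> 2 * (t * z)" "2 * (t * z) \<le> z" "- z \<le> 2 * (u * z)" "2 * (u * z) \<le> z"
      by (simp_all add: mult.assoc)
  qed
  have pm: "0 \<le> x + y" "0 \<le> x - y" using y by linarith+
  \<comment> \<open>Naming the four products makes the remaining estimates linear.\<close>
  define tp tm up um where "tp = t * (x + y)" "tm = t * (x - y)" "up = u * (x + y)" "um = u * (x - y)"
  note defs = this
  note half_pm = half[OF pm(1), folded defs] half[OF pm(2), folded defs]
  have dist: "t * (x + y) = t * x + t * y" "t * (x - y) = t * x - t * y"
    "u * (x + y) = u * x + u * y" "u * (x - y) = u * x - u * y"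
    by (simp_all add: algebra_simps)
  have XY: "X + Y = tp + um" "X - Y = tm - up"
    unfolding X Y defs dist by simp_all
  have le: "X + Y \<le> x" "- (X + Y) \<le> x" "X - Y \<le> x" "- (X - Y) \<le> x"
    unfolding XY using half_pm by linarith+
  then show "\<bar>X\<bar> + \<bar>Y\<bar> \<le> x" by linarith
  have "0 \<le> x" using y by linarith
  then have "\<bar>t * x\<bar> \<le> 1 / 2 * x" "\<bar>u * y\<bar> \<le> 1 / 2 * \<bar>y\<bar>"
    using mult_right_mono[OF t(1), of "\<bar>x\<bar>"] mult_right_mono[OF t(2), of "\<bar>y\<bar>"] by (simp_all add: abs_mult)
  then show "2 * \<bar>X\<bar> \<le> x + \<bar>y\<bar>" unfolding X using abs_triangle_ineq4[of "t * x" "u * y"] by argo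
  show "2 * \<bar>X\<bar> = x + \<bar>y\<bar> \<or> 2 * \<bar>X\<bar> = x - \<bar>y\<bar>" if eq: "\<bar>X\<bar> + \<bar>Y\<bar> = x" and ne: "\<bar>y\<bar> \<noteq> x"
  proof -
    have pos: "0 < x + y" "0 < x - y" using ne y by linarith+
    have half_eq: "2 * (v * z) = z \<Longrightarrow> v = 1 / 2" "2 * (v * z) = - z \<Longrightarrow> v = - 1 / 2" if "0 < z" for v z :: real
    proof -
      show "v = 1 / 2" if "2 * (v * z) = z" using that \<open>0 < z\<close> by (simp add: field_simps)
      show "v = - 1 / 2" if "2 * (v * z) = - z"
      proof -
        have "(2 * v + 1) * z = 0" using that by (simp add: algebra_simps)
        then show ?thesis using \<open>0 < z\<close> by simp
      qed
    qed
    have "X + Y = x \<or> X - Y = x \<or> - (X - Y) = x \<or> - (X + Y) = x" using eq by linarith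
    then have "(t = 1 / 2 \<or> t = - 1 / 2) \<and> (u = 1 / 2 \<or> u = - 1 / 2)"
    proof (elim disjE)
      assume *: "X + Y = x"
      have "2 * tp = (x + y)" "2 * um = (x - y)"
        using * half_pm unfolding XY by linarith+
      then show ?thesis using half_eq pos unfolding defs by blast
    next
      assume *: "X - Y = x"
      have "2 * tm = (x - y)" "2 * up = - (x + y)"
        using * half_pm unfolding XY by linarith+
      then show ?thesis using half_eq pos unfolding defs by blast
    next
      assume *: "- (X - Y) = x"
      have "2 * tm = - (x - y)" "2 * up = (x + y)"
        using * half_pm unfolding XY by linarith+
      then show ?thesis using half_eq pos unfolding defs by blast
    next
      assume *: "- (X + Y) = x"
      have "2 * tp = - (x + y)" "2 * um = - (x - y)"
        using * half_pm unfolding XY by linarith+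
      then show ?thesis using half_eq pos unfolding defs by blast
    qed
    then have "2 * X = x - y \<or> 2 * X = x + y \<or> 2 * X = - x - y \<or> 2 * X = - x + y"
      unfolding X by (elim conjE disjE) (simp_all only:, simp_all)
    then show ?thesis using pos by linarith
  qed
qed

section \<open>Integer coordinates, valuations and normalising units\<close>

lemma w_seq_eq_w: "0 < n \<Longrightarrow> w_seq (int n - 1) = of_int (w (n - 1))"
proof -
  assume "0 < n"
  then have n: "int n - 1 = int (n - 1)" by simp
  have "int (n - 1) div 2 = int ((n - 1) div 2)" by (simp only: zdiv_int of_nat_numeral)
  then show ?thesis unfolding w_seq_def w_def n by simp
qed

lemma gauss_ints_Complex: "z \<in> gauss_ints \<longleftrightarrow> (\<exists>x y. z = Complex (of_int x) (of_int y))"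
proof
  assume "z \<in> gauss_ints"
  then obtain x y where "Re z = of_int x" "Im z = of_int y"
    unfolding gauss_ints_def by (metis Ints_cases mem_Collect_eq)
  then show "\<exists>x y. z = Complex (of_int x) (of_int y)" by (metis complex_surj)
qed (auto simp: gauss_ints_def)

lemma v2_eq:
  assumes "odd x \<or> odd y"
  shows "v2 (Complex (of_int (2 ^ s * x)) (of_int (2 ^ s * y))) = s"
proof -
  have eq: "Complex (of_int (2 ^ s * x)) (of_int (2 ^ s * y)) = 2 ^ j * Complex (of_int u) (of_int v)
      \<longleftrightarrow> 2 ^ s * x = 2 ^ j * u \<and> 2 ^ s * y = 2 ^ j * v" for j u v
  proof -
    have "2 ^ j * Complex (of_int u) (of_int v) = Complex (of_int (2 ^ j * u)) (of_int (2 ^ j * v))"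
      using complex_of_real_mult_Complex[of "2 ^ j" "of_int u" "of_int v"]
      by (simp only: of_real_power of_real_numeral of_int_mult of_int_power of_int_numeral)
    then show ?thesis by (simp only: complex.inject of_int_eq_iff)
  qed
  have "j \<le> s" if j: "2 ^ s * x = 2 ^ j * u" "2 ^ s * y = 2 ^ j * v" for j u v
  proof (rule ccontr)
    assume "\<not> j \<le> s"
    then obtain d where d: "j = s + Suc d" using less_imp_Suc_add[of s j] by auto
    then have "x = 2 * (2 ^ d * u)" "y = 2 * (2 ^ d * v)" using j by (simp_all add: power_add)
    then show False using assms by auto
  qed
  note le = this
  let ?S = "{j. \<exists>c \<in> gauss_ints. Complex (of_int (2 ^ s * x)) (of_int (2 ^ s * y)) = 2 ^ j * c}"
  have sub: "?S \<subseteq> {..s}"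
  proof
    fix j assume "j \<in> ?S"
    then obtain c where c: "c \<in> gauss_ints" "Complex (of_int (2 ^ s * x)) (of_int (2 ^ s * y)) = 2 ^ j * c"
      by blast
    moreover obtain u v where "c = Complex (of_int u) (of_int v)" using c(1) gauss_ints_Complex by metis
    ultimately have "Complex (of_int (2 ^ s * x)) (of_int (2 ^ s * y)) = 2 ^ j * Complex (of_int u) (of_int v)"
      by simp
    then show "j \<in> {..s}" using le[of j u v] unfolding eq by simp
  qed
  have "Complex (of_int x) (of_int y) \<in> gauss_ints" using gauss_ints_Complex by metis
  then have "s \<in> ?S" using eq[of s x y] by (intro CollectI bexI) simp_all
  then show ?thesis
    unfolding v2_def using sub finite_subset[OF sub] by (intro Max_eqI) (simp_all only: subset_iff atMost_iff finite_atMost)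
qed

lemma is_unit_of_normal:
  assumes "is_unit_of z u"
  shows "u \<in> gauss_units" "Re (u * z) = linf z" "\<bar>Im (u * z)\<bar> = lmin z"
proof -
  show u: "u \<in> gauss_units" using assms by (simp add: is_unit_of_def)
  show *: "Re (u * z) = linf z"
  proof (cases "linf z = lmin z")
    case True
    then have "u * z = of_real (linf z) * (1 + \<i>)" using assms by (simp add: is_unit_of_def)
    then show ?thesis by (simp only:) simp
  qed (use assms in \<open>simp add: is_unit_of_def\<close>)
  show "\<bar>Im (u * z)\<bar> = lmin z"
  proof -
    have "\<bar>Re (u * z)\<bar> = \<bar>Re z\<bar> \<and> \<bar>Im (u * z)\<bar> = \<bar>Im z\<bar> \<or> \<bar>Re (u * z)\<bar> = \<bar>Im z\<bar> \<and> \<bar>Im (u * z)\<bar> = \<bar>Re z\<bar>"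
      using u unfolding gauss_units_def by auto
    then show ?thesis using * unfolding linf_def lmin_def by linarith
  qed
qed

section \<open>Levels of Gaussian integers and the corrected division step\<close>

definition level :: "nat \<Rightarrow> complex \<Rightarrow> bool" where
  "level n z \<longleftrightarrow> (\<exists>x y. z = Complex (of_int x) (of_int y) \<and> in_level n x y)"

lemma level_Complex [simp]: "level n (Complex (of_int x) (of_int y)) \<longleftrightarrow> in_level n x y"
  by (auto simp: level_def)

lemma level_unit_mult: "u \<in> gauss_units \<Longrightarrow> level n z \<Longrightarrow> level n (u * z)"
proof -
  assume u: "u \<in> gauss_units" and "level n z"
  then obtain x y where z: "z = Complex (of_int x) (of_int y)" and l: "in_level n x y"
    by (auto simp: level_def)
  have l': "in_level n y x" using l in_level_swap by blast
  have neg: "in_level n (-x) (-y)" "in_level n (-y) x" "in_level n y (-x)"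
    by (rule in_level_abs[OF _ _ l] in_level_abs[OF _ _ l'], simp, simp)+
  have u: "u = 1 \<or> u = -1 \<or> u = \<i> \<or> u = -\<i>" using u by (simp add: gauss_units_def)
  have "u * z = Complex (of_int x) (of_int y) \<or> u * z = Complex (of_int (-x)) (of_int (-y)) \<or>
      u * z = Complex (of_int (-y)) (of_int x) \<or> u * z = Complex (of_int y) (of_int (-x))"
    unfolding z using u by (elim disjE) (simp_all add: complex_eq_iff)
  then show ?thesis using l neg unfolding level_def by blast
qed

lemma gauss_units_facts:
  assumes "u \<in> gauss_units"
  shows "u \<in> gauss_ints" "cnj u \<in> gauss_units" "u * cnj u = 1" "u \<noteq> 0"
  using assms by (auto simp: gauss_units_def gauss_ints_def)

lemma gauss_units_mult: "u \<in> gauss_units \<Longrightarrow> v \<in> gauss_units \<Longrightarrow> u * v \<in> gauss_units"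
  by (auto simp: gauss_units_def)

lemma gauss_units_divide:
  assumes "u \<in> gauss_units" "v \<in> gauss_units"
  shows "u / v = u * cnj v" "u / v \<in> gauss_units"
proof -
  show *: "u / v = u * cnj v"
    using gauss_units_facts[OF assms(2)] by (simp add: divide_eq_eq mult.assoc mult.commute)
  show "u / v \<in> gauss_units" unfolding * using assms gauss_units_facts gauss_units_mult by blast
qed

lemma v2_unit_mult:
  assumes "u \<in> gauss_units"
  shows "v2 (u * z) = v2 z"
proof -
  note u = gauss_units_facts[OF assms]
  have "(\<exists>c\<in>gauss_ints. u * z = 2 ^ j * c) \<longleftrightarrow> (\<exists>c\<in>gauss_ints. z = 2 ^ j * c)" for j
  proof
    assume "\<exists>c\<in>gauss_ints. u * z = 2 ^ j * c"
    then obtain c where c: "c \<in> gauss_ints" "u * z = 2 ^ j * c" by blast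
    have "z = (u * cnj u) * z" using u(3) by simp
    also have "\<dots> = 2 ^ j * (cnj u * c)" using c(2) by (simp add: ac_simps)
    finally show "\<exists>c\<in>gauss_ints. z = 2 ^ j * c"
      by (rule bexI) (rule gauss_ints_closed(3)[OF gauss_ints_closed(4)[OF u(1) u(1)] c(1)])
  next
    assume "\<exists>c\<in>gauss_ints. z = 2 ^ j * c"
    then obtain c where c: "c \<in> gauss_ints" "z = 2 ^ j * c" by blast
    then have "u * z = 2 ^ j * (u * c)" by (simp add: ac_simps)
    then show "\<exists>c\<in>gauss_ints. u * z = 2 ^ j * c"
      by (rule bexI) (rule gauss_ints_closed(3)[OF u(1) c(1)])
  qed
  then show ?thesis unfolding v2_def by simp
qed

lemma level_nonzero: "level n z \<Longrightarrow> z \<in> gauss_ints - {0}"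
  unfolding level_def in_level_def by (auto simp: gauss_ints_def complex_eq_iff)

lemma level_mono: "level m z \<Longrightarrow> m \<le> n \<Longrightarrow> level n z"
  unfolding level_def using in_level_mono by blast

lemma level_exists:
  assumes "z \<in> gauss_ints - {0}"
  shows "\<exists>n. level n z"
proof -
  obtain x y where z: "z = Complex (of_int x) (of_int y)" using assms gauss_ints_Complex by blast
  then have "x \<noteq> 0 \<or> y \<noteq> 0" using assms by (auto simp: complex_eq_iff)
  then show ?thesis using in_level_exists z by auto
qed

text \<open>The units \<open>u\<close> and \<open>v\<close> turn \<open>b\<close> and
  \<open>r\<close> so that the real part dominates, and \<open>remainder_level\<close> applies with
  \<open>c\<close> and \<open>S\<close> from the absolute imaginary parts. Equal signs of the
  imaginary parts lead to its second claim, opposite signs under \<open>cond\<close> to the third,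
  and failure of \<open>cond\<close> to the fourth. Multiplication by \<open>cnj v\<close> leads
  back.\<close>

lemma remainder_step:
  assumes b: "b \<in> gauss_ints - {0}" and r: "r \<in> gauss_ints - {0}"
    and t: "r = t * b" "\<bar>Re t\<bar> \<le> 1 / 2" "\<bar>Im t\<bar> \<le> 1 / 2"
    and n: "level n b" "n = 0 \<or> \<not> level (n - 1) r"
  defines "cond \<equiv> Im (unit_of b * b) * Im (unit_of r * r) \<ge> 0
        \<or> lmin r + lmin b \<le> linf r
        \<or> (lmin b < linf r \<and> linf r < lmin b + lmin r
            \<and> linf b - lmin r > w_seq (int n - 1) - 2 ^ (v2 b + 1))"
  shows "0 < n"
    and "cond \<Longrightarrow> level (n - 1) (r - unit_of b / unit_of r * b)"
    and "\<not> cond \<Longrightarrow> level (n - 1) (r - \<i> * unit_of b / (s_sign r * unit_of r) * b)"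
proof -
  define u v where "u = unit_of b" and "v = unit_of r"
  have "is_unit_of b u" "is_unit_of r v" using b r is_unit_of_unit_of by (auto simp: u_def v_def)
  note u = is_unit_of_normal[OF this(1)] and v = is_unit_of_normal[OF this(2)]
  note u' = gauss_units_facts[OF u(1)] and v' = gauss_units_facts[OF v(1)]
  have "level n (u * b)" using level_unit_mult u(1) n(1) by blast
  then obtain x0 y0 where ub: "u * b = Complex (of_int x0) (of_int y0)" and lb: "in_level n x0 y0"
    by (auto simp: level_def)
  obtain s B y where s: "x0 = 2 ^ s * B" "y0 = 2 ^ s * y" "odd B \<or> odd y"
    using lb unfolding in_level_def by blast
  define P :: int where "P = 2 ^ s"
  have P: "0 < P" by (simp add: P_def)
  define c where "c = \<bar>y\<bar>"
  have "v * r \<in> gauss_ints" using v'(1) r gauss_ints_closed by auto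
  then obtain R Y where vr: "v * r = Complex (of_int R) (of_int Y)" using gauss_ints_Complex by blast
  define S where "S = \<bar>Y\<bar>"
  have linf_b: "linf b = of_int (P * B)" and lmin_b: "lmin b = of_int (P * c)"
    using u(2,3) unfolding ub s by (simp_all add: P_def c_def abs_mult)
  have linf_r: "linf r = of_int R" and lmin_r: "lmin r = of_int S"
    using v(2,3) unfolding vr by (simp_all add: S_def)
  have "lmin b \<le> linf b" "lmin r \<le> linf r" by (simp_all add: lmin_def linf_def)
  then have "P * c \<le> P * B" and SR: "S \<le> R"
    unfolding linf_b lmin_b linf_r lmin_r by (simp_all only: of_int_le_iff)
  then have cB: "c \<le> B" using P by simp
  have c0: "0 \<le> c" "0 \<le> S" by (simp_all add: c_def S_def)
  have v2b: "v2 b = s"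
    using v2_unit_mult[OF u(1), of b] v2_eq[OF s(3), of s] unfolding ub s by simp
  have R0: "0 < R"
  proof (rule ccontr)
    assume "\<not> 0 < R"
    then have "R = 0" "Y = 0" using SR c0 by (auto simp: S_def)
    then have "v * r = 0" using vr by (simp add: complex_eq_iff)
    then show False using v'(4) r by simp
  qed
  \<comment> \<open>The square of half-width 1/2 is invariant under units, so the normalised
    quotient obeys the bounds of \<open>t\<close>.\<close>
  define t' where "t' = (v * cnj u) * t"
  have "v * r = t' * (u * b)"
    unfolding t'_def t(1) using u'(3) by (simp add: ac_simps)
  then have t'_eq: "of_int R = Re t' * of_int (P * B) - Im t' * of_int y0"
      "of_int Y = Re t' * of_int y0 + Im t' * of_int (P * B)"
    unfolding ub vr s P_def by (simp_all add: complex_eq_iff)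
  have "\<bar>Re (e * t)\<bar> \<le> 1 / 2 \<and> \<bar>Im (e * t)\<bar> \<le> 1 / 2" if "e \<in> gauss_units" for e
    using that t(2,3) by (auto simp: gauss_units_def)
  then have t': "\<bar>Re t'\<bar> \<le> 1 / 2" "\<bar>Im t'\<bar> \<le> 1 / 2"
    unfolding t'_def using u'(2) v(1) gauss_units_mult by blast+
  have y0: "\<bar>y0\<bar> = P * c" by (simp add: s P_def c_def abs_mult)
  have "\<bar>of_int y0\<bar> \<le> (of_int (P * B) :: real)"
    using \<open>P * c \<le> P * B\<close> y0 by (simp only: of_int_abs[symmetric] of_int_le_iff)
  note bounds = half_square_bounds[OF t' this t'_eq]
  have real_y0: "\<bar>of_int y0\<bar> = (of_int (P * c) :: real)" by (simp only: y0 of_int_abs[symmetric])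
  have real_R: "\<bar>of_int R\<bar> = (of_int R :: real)" and real_Y: "\<bar>of_int Y\<bar> = (of_int S :: real)"
    using R0 by (simp_all add: S_def)
  note bounds = bounds[unfolded real_y0 real_R real_Y]
  have b1: "2 * R \<le> P * B + P * c" "R + S \<le> P * B" using bounds(1,2) by linarith+
  have b2: "R + S = P * B \<longrightarrow> 2 * R = P * B + P * c \<or> 2 * R = P * B - P * c \<or> B = c"
  proof
    assume "R + S = P * B"
    then have *: "(of_int R :: real) + of_int S = of_int (P * B)" by linarith
    show "2 * R = P * B + P * c \<or> 2 * R = P * B - P * c \<or> B = c"
    proof (cases "B = c")
      case False
      then have "P * c \<noteq> P * B" using P by auto
      then have "(of_int (P * c) :: real) \<noteq> of_int (P * B)" by (simp only: of_int_eq_iff not_False_eq_True)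
      then show ?thesis using bounds(3)[OF *] by linarith
    qed simp
  qed
  have x0: "x0 = P * B" by (simp add: s P_def)
  have lb': "in_level n (P * B) (P * c)"
    by (rule in_level_abs[OF _ _ lb]) (use P c0(1) in \<open>simp_all add: x0 y0\<close>)
  have unmult: "level (n - 1) z" if "level (n - 1) (v * z)" for z
  proof -
    have "cnj v * (v * z) = (v * cnj v) * z" by (simp only: ac_simps)
    then have "cnj v * (v * z) = z" unfolding v'(3) by simp
    then show ?thesis using level_unit_mult[OF v'(2) that] by metis
  qed
  have nr: "n = 0 \<or> \<not> in_level (n - 1) R S"
  proof (rule ccontr)
    assume "\<not> ?thesis"
    then have "in_level (n - 1) R Y" "0 < n" using in_level_abs[of R R S Y] by (auto simp: S_def)
    then have "level (n - 1) (v * r)" unfolding vr by simp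
    then show False using unmult n(2) \<open>0 < n\<close> by blast
  qed
  have "odd B \<or> odd c" using s(3) by (simp add: c_def)
  note step = remainder_level[OF P_def this c0(1) cB lb' c0(2) SR R0 b1 b2 nr]
  show "0 < n" by (rule step(1))
  have w: "w_seq (int n - 1) = of_int (w (n - 1))" by (rule w_seq_eq_w[OF step(1)])
  have Im: "Im (unit_of b * b) * Im (unit_of r * r) = of_int (y0 * Y)"
    unfolding u_def[symmetric] v_def[symmetric] ub vr by simp
  have "w_seq (int n - 1) - 2 ^ (v2 b + 1) = of_int (w (n - 1) - 2 * P)"
    unfolding w v2b P_def by simp
  then have "cond \<longleftrightarrow> 0 \<le> real_of_int (y0 * Y) \<or> (of_int S :: real) + of_int (P * c) \<le> of_int R
     \<or> (of_int (P * c) :: real) < of_int R \<and> (of_int R :: real) < of_int (P * c) + of_int S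
      \<and> of_int (w (n - 1) - 2 * P) < of_int (P * B) - (of_int S :: real)"
    unfolding cond_def linf_b lmin_b linf_r lmin_r Im by simp
  also have "\<dots> \<longleftrightarrow> 0 \<le> y0 * Y \<or> S + P * c \<le> R \<or> P * c < R \<and> R < P * c + S \<and> w (n - 1) - 2 * P < P * B - S"
    by (simp only: of_int_add[symmetric] of_int_diff[symmetric] of_int_less_iff of_int_le_iff of_int_0_le_iff)
  finally have cond: "cond \<longleftrightarrow> 0 \<le> y0 * Y \<or> S + P * c \<le> R
     \<or> P * c < R \<and> R < P * c + S \<and> w (n - 1) - 2 * P < P * B - S" .
  show "level (n - 1) (r - unit_of b / unit_of r * b)" if cond
  proof -
    have "in_level (n - 1) (R - P * B) (Y - y0)"
    proof (cases "0 \<le> y0 * Y")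
      case True
      then have "\<bar>P * c - S\<bar> = \<bar>Y - y0\<bar>" unfolding y0[symmetric] S_def by (auto simp: zero_le_mult_iff)
      then show ?thesis using in_level_abs[OF _ _ step(2)] by (metis abs_minus_commute)
    next
      case False
      then have "\<bar>P * c + S\<bar> = \<bar>Y - y0\<bar>" "0 < S" unfolding y0[symmetric] S_def by (auto simp: mult_less_0_iff not_le)
      moreover have "S + P * c \<le> R \<or> w (n - 1) - 2 * P < P * B - S" using that False unfolding cond by blast
      ultimately show ?thesis using in_level_abs[OF _ _ step(3)] by (metis abs_minus_commute)
    qed
    moreover have "v * (r - u / v * b) = v * r - u * b" using v'(4) by (simp add: right_diff_distrib)
    then have "v * (r - u / v * b) = Complex (of_int (R - P * B)) (of_int (Y - y0))"
      unfolding ub vr x0 by (simp add: complex_eq_iff)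
    ultimately have "level (n - 1) (v * (r - u / v * b))" by (simp only: level_Complex)
    then show ?thesis using unmult by (simp add: u_def v_def)
  qed
  show "level (n - 1) (r - \<i> * unit_of b / (s_sign r * unit_of r) * b)" if ncond: "\<not> cond"
  proof -
    define e where "e = sgn Y"
    \<comment> \<open>In particular \<open>Y\<close> is nonzero, so \<open>e\<close> is 1 or -1 and
      dividing by the sign is the same as multiplying by it.\<close>
    have neg: "y0 * Y < 0" using ncond unfolding cond by auto
    then have e: "e = 1 \<and> y0 = - (P * c) \<and> Y = S \<or> e = - 1 \<and> y0 = P * c \<and> Y = - S"
      using y0 by (auto simp: e_def S_def mult_less_0_iff)
    have "0 < S" using neg by (auto simp: S_def)
    moreover have "R < S + P * c" "R \<le> P * c \<or> P * B - S \<le> w (n - 1) - 2 * P"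
      using ncond unfolding cond by linarith+
    ultimately have l: "in_level (n - 1) (R - P * c) (P * B - S)" by (rule step(4))
    have "\<bar>R - P * c\<bar> = \<bar>R + e * y0\<bar>" "\<bar>P * B - S\<bar> = \<bar>Y - e * (P * B)\<bar>" using e by auto
    then have "in_level (n - 1) (R + e * y0) (Y - e * (P * B))" by (rule in_level_abs[OF _ _ l])
    moreover have se: "s_sign r = of_int e"
      unfolding s_sign_def v_def[symmetric] vr e_def by (simp add: sgn_if)
    have "v * (r - \<i> * u / (complex_of_real (of_int e) * v) * b) = v * r - of_int e * \<i> * (u * b)"
      using e by (elim disjE conjE; simp only:; use v'(4) in \<open>simp add: right_diff_distrib distrib_left\<close>)
    then have "v * (r - \<i> * u / (s_sign r * v) * b) = Complex (of_int (R + e * y0)) (of_int (Y - e * (P * B)))"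
      unfolding ub vr x0 se by (simp add: complex_eq_iff)
    ultimately have "level (n - 1) (v * (r - \<i> * u / (s_sign r * v) * b))" by (simp only: level_Complex)
    then show ?thesis using unmult by (simp add: u_def v_def)
  qed
qed

lemma gauss_remainder_bounds:
  assumes "b \<noteq> 0"
  obtains t where "gauss_rem a b = t * b" "\<bar>Re t\<bar> \<le> 1 / 2" "\<bar>Im t\<bar> \<le> 1 / 2"
proof
  let ?t = "a * cnj b / of_real (Nm b) - gauss_quot a b"
  have "of_real (Nm b) = b * cnj b"
    by (simp add: complex_eq_iff Nm_def power2_eq_square)
  then have "a * cnj b / of_real (Nm b) * b = a" using assms by simp
  then show "gauss_rem a b = ?t * b" unfolding gauss_rem_def by (simp add: left_diff_distrib)
  show "\<bar>Re ?t\<bar> \<le> 1 / 2" "\<bar>Im ?t\<bar> \<le> 1 / 2"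
    using gauss_round_close by (simp_all only: gauss_quot_def Let_def minus_complex.sel complex.sel)
qed

lemma gauss_quot_rem_ints:
  assumes "a \<in> gauss_ints" "b \<in> gauss_ints"
  shows "gauss_quot a b \<in> gauss_ints" "gauss_rem a b \<in> gauss_ints"
proof -
  show q: "gauss_quot a b \<in> gauss_ints"
    by (simp add: gauss_quot_def gauss_ints_def Let_def)
  show "gauss_rem a b \<in> gauss_ints"
    unfolding gauss_rem_def using assms q gauss_ints_closed by blast
qed

subsection \<open>Residue systems of bounded level\<close>

text \<open>Both sums of absolute values are compared through the Euclidean norm. The factor 10 is
  3^2 + 1^2, the least norm of g + h i with \<open>g\<close> and \<open>h\<close> odd and not both
  of absolute value 1.\<close>

lemma abs_bounds_of_norm_le:
  fixes p q x y :: int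
  assumes "10 * (x\<^sup>2 + y\<^sup>2) \<le> p\<^sup>2 + q\<^sup>2"
  shows "\<bar>x\<bar> + \<bar>y\<bar> \<le> max \<bar>p\<bar> \<bar>q\<bar>" "2 * max \<bar>x\<bar> \<bar>y\<bar> \<le> \<bar>p\<bar> + \<bar>q\<bar>"
proof -
  define M where "M = max \<bar>p\<bar> \<bar>q\<bar>"
  have "\<bar>p\<bar>\<^sup>2 \<le> M\<^sup>2" "\<bar>q\<bar>\<^sup>2 \<le> M\<^sup>2" by (rule power_mono; simp add: M_def)+
  moreover have "(\<bar>x\<bar> + \<bar>y\<bar>)\<^sup>2 + (\<bar>x\<bar> - \<bar>y\<bar>)\<^sup>2 = 2 * (x\<^sup>2 + y\<^sup>2)"
    by (simp add: power2_sum power2_diff)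
  moreover have "0 \<le> (\<bar>x\<bar> - \<bar>y\<bar>)\<^sup>2" "0 \<le> x\<^sup>2" "0 \<le> y\<^sup>2" by simp_all
  \<comment> \<open>Variables stand for the squares, so that the estimate is linear.\<close>
  moreover have "A \<le> m" if "P \<le> m" "Q \<le> m" "A + D = 2 * (X + Y)" "0 \<le> D" "0 \<le> X" "0 \<le> Y"
      "10 * (X + Y) \<le> P + Q" for A D P Q X Y m :: int
    using that unfolding distrib_left by linarith
  ultimately have "(\<bar>x\<bar> + \<bar>y\<bar>)\<^sup>2 \<le> M\<^sup>2" using assms unfolding power2_abs by blast
  then show "\<bar>x\<bar> + \<bar>y\<bar> \<le> max \<bar>p\<bar> \<bar>q\<bar>" unfolding M_def by (rule power2_le_imp_le) simp
  have "(\<bar>p\<bar> + \<bar>q\<bar>)\<^sup>2 = p\<^sup>2 + q\<^sup>2 + 2 * (\<bar>p\<bar> * \<bar>q\<bar>)" by (simp add: power2_sum)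
  moreover have "0 \<le> \<bar>p\<bar> * \<bar>q\<bar>" by simp
  moreover have "(2 * x)\<^sup>2 = 4 * x\<^sup>2" "(2 * y)\<^sup>2 = 4 * y\<^sup>2" by (simp_all add: power_mult_distrib)
  ultimately have "\<bar>2 * x\<bar>\<^sup>2 \<le> (\<bar>p\<bar> + \<bar>q\<bar>)\<^sup>2" "\<bar>2 * y\<bar>\<^sup>2 \<le> (\<bar>p\<bar> + \<bar>q\<bar>)\<^sup>2"
    using assms \<open>0 \<le> x\<^sup>2\<close> \<open>0 \<le> y\<^sup>2\<close> unfolding power2_abs distrib_left by linarith+
  then have "\<bar>2 * x\<bar> \<le> \<bar>p\<bar> + \<bar>q\<bar>" "\<bar>2 * y\<bar> \<le> \<bar>p\<bar> + \<bar>q\<bar>" by (auto intro: power2_le_imp_le)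
  then show "2 * max \<bar>x\<bar> \<bar>y\<bar> \<le> \<bar>p\<bar> + \<bar>q\<bar>" by (simp add: max_def abs_mult)
qed

text \<open>Multiplying a + b i by 1 + i is a rotation by 45 degrees with scaling and exchanges the
  two norms up to a factor. This makes octagons of consecutive index correspond.\<close>

lemma abs_sum_diff:
  fixes a b :: int
  shows "max \<bar>a - b\<bar> \<bar>a + b\<bar> = \<bar>a\<bar> + \<bar>b\<bar>" "\<bar>a - b\<bar> + \<bar>a + b\<bar> = 2 * max \<bar>a\<bar> \<bar>b\<bar>"
  by (smt (verit))+

lemma abs_half_sum_diff:
  fixes a b c d :: int
  assumes "a - b = 2 * c" "a + b = 2 * d"
  shows "\<bar>a\<bar> + \<bar>b\<bar> = 2 * max \<bar>c\<bar> \<bar>d\<bar>" "max \<bar>a\<bar> \<bar>b\<bar> = \<bar>c\<bar> + \<bar>d\<bar>"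
  using abs_sum_diff[of a b] unfolding assms abs_mult by (simp_all add: max_def split: if_splits)

text \<open>p + q i is the product of x + y i and g + h i. If \<open>g\<close> and \<open>h\<close>
  have absolute value 1, both bounds are equalities by \<open>abs_sum_diff\<close>; every other odd
  pair has norm at least 10.\<close>

lemma odd_multiple_bounds:
  fixes x y g h :: int
  assumes "odd g" "odd h"
  defines "p \<equiv> x * g - y * h" and "q \<equiv> x * h + y * g"
  shows "\<bar>x\<bar> + \<bar>y\<bar> \<le> max \<bar>p\<bar> \<bar>q\<bar>" "2 * max \<bar>x\<bar> \<bar>y\<bar> \<le> \<bar>p\<bar> + \<bar>q\<bar>"
proof -
  have "\<bar>x\<bar> + \<bar>y\<bar> \<le> max \<bar>p\<bar> \<bar>q\<bar> \<and> 2 * max \<bar>x\<bar> \<bar>y\<bar> \<le> \<bar>p\<bar> + \<bar>q\<bar>"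
  proof (cases "\<bar>g\<bar> = 1 \<and> \<bar>h\<bar> = 1")
    case True
    then have "(g = 1 \<or> g = -1) \<and> (h = 1 \<or> h = -1)" by linarith
    then have "\<bar>p\<bar> = \<bar>x - y\<bar> \<and> \<bar>q\<bar> = \<bar>x + y\<bar> \<or> \<bar>p\<bar> = \<bar>x + y\<bar> \<and> \<bar>q\<bar> = \<bar>x - y\<bar>"
      unfolding p_def q_def by auto
    then have "max \<bar>p\<bar> \<bar>q\<bar> = max \<bar>x - y\<bar> \<bar>x + y\<bar>" "\<bar>p\<bar> + \<bar>q\<bar> = \<bar>x - y\<bar> + \<bar>x + y\<bar>"
      by (auto simp: max.commute)
    then show ?thesis unfolding abs_sum_diff by simp
  next
    case False
    have "1 \<le> \<bar>g\<bar>" "1 \<le> \<bar>h\<bar>" using assms(1,2) by (presburger)+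
    moreover have "\<bar>g\<bar> \<noteq> 2" "\<bar>h\<bar> \<noteq> 2" using assms(1,2) by presburger+
    ultimately have "3 \<le> \<bar>g\<bar> \<or> 3 \<le> \<bar>h\<bar>" using False by linarith
    moreover have sq: "b\<^sup>2 \<le> a\<^sup>2" if "0 \<le> b" "b \<le> \<bar>a\<bar>" for a b :: int
      using power_mono[OF that(2,1), of 2] by simp
    ultimately have "10 \<le> g\<^sup>2 + h\<^sup>2"
      using sq[of 1 g] sq[of 1 h] sq[of 3 g] sq[of 3 h] \<open>1 \<le> \<bar>g\<bar>\<close> \<open>1 \<le> \<bar>h\<bar>\<close> by auto
    then have "10 * (x\<^sup>2 + y\<^sup>2) \<le> (g\<^sup>2 + h\<^sup>2) * (x\<^sup>2 + y\<^sup>2)" by (intro mult_right_mono) simp_all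
    also have "\<dots> = p\<^sup>2 + q\<^sup>2" unfolding p_def q_def by (simp add: power2_eq_square algebra_simps)
    finally show ?thesis using abs_bounds_of_norm_le by blast
  qed
  then show "\<bar>x\<bar> + \<bar>y\<bar> \<le> max \<bar>p\<bar> \<bar>q\<bar>" "2 * max \<bar>x\<bar> \<bar>y\<bar> \<le> \<bar>p\<bar> + \<bar>q\<bar>" by blast+
qed

text \<open>For z = x + y i the point is (1 + i) (z + 1) / 2 - (e + f i) z. Doubled, it is an odd
  multiple (g + h i) z plus 1 + i. Removing 1 + i costs 1 per coordinate, and
  \<open>odd_multiple_bounds\<close> turns the margins of index \<open>m\<close> into exactly those
  of index \<open>Suc m\<close>.\<close>

lemma octagon_of_deep_hole:
  fixes x y e f :: int
  assumes odd: "odd (x + y)"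
    and oct: "octagon m ((x - y + 1) div 2 - (e * x - f * y)) ((x + y + 1) div 2 - (e * y + f * x))"
  shows "octagon (Suc m) x y"
proof -
  define g h where "g = 1 - 2 * e" and "h = 1 - 2 * f"
  have gh: "odd g" "odd h" by (simp_all add: g_def h_def)
  define p q where "p = x * g - y * h" and "q = x * h + y * g"
  have "2 * ((x - y + 1) div 2) = x - y + 1" "2 * ((x + y + 1) div 2) = x + y + 1"
    using odd by presburger+
  then have 2: "2 * ((x - y + 1) div 2 - (e * x - f * y)) = p + 1"
      "2 * ((x + y + 1) div 2 - (e * y + f * x)) = q + 1"
    unfolding p_def q_def g_def h_def by (simp_all add: algebra_simps)
  have "\<bar>p + 1\<bar> \<le> 2 * w m - 4" "\<bar>q + 1\<bar> \<le> 2 * w m - 4"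
    "\<bar>p + 1\<bar> + \<bar>q + 1\<bar> \<le> 2 * w (Suc m) - 6"
    using oct unfolding octagon_def 2[symmetric] abs_mult by simp_all
  moreover have "\<bar>p\<bar> \<le> \<bar>p + 1\<bar> + 1" "\<bar>q\<bar> \<le> \<bar>q + 1\<bar> + 1" by linarith+
  ultimately have "max \<bar>p\<bar> \<bar>q\<bar> \<le> 2 * w m - 3" "\<bar>p\<bar> + \<bar>q\<bar> \<le> 2 * w (Suc m) - 4"
    unfolding max.bounded_iff by linarith+
  then have "\<bar>x\<bar> + \<bar>y\<bar> \<le> 2 * w m - 3" "2 * max \<bar>x\<bar> \<bar>y\<bar> \<le> 2 * w (Suc m) - 4"
    using odd_multiple_bounds[OF gh, of x y, folded p_def q_def] by linarith+
  then show ?thesis unfolding octagon_def w_simps by linarith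
qed

text \<open>Write the point as 2^s (a + b i). If \<open>a + b\<close> is odd, the factor 1 + i adds
  no factor 2, and parity sharpens the bound on the sum by 1. If \<open>a + b\<close> is even, both
  are odd and exactly one factor 2 appears, so the octagon index drops by two.\<close>

lemma in_level_rotate_scaleD:
  assumes "in_level n (x - y) (x + y)"
  shows "0 < n \<and> in_level (n - 1) x y"
proof -
  have "x \<noteq> 0 \<or> y \<noteq> 0" using assms by (auto simp: in_level_def)
  then obtain s a b where s: "x = 2 ^ s * a" "y = 2 ^ s * b" "odd a \<or> odd b"
    using power2_factor_exists by metis
  show ?thesis
  proof (cases "odd (a + b)")
    case True
    then have "odd (a - b) \<or> odd (a + b)" by simp
    moreover have "in_level n (2 ^ s * (a - b)) (2 ^ s * (a + b))" using assms s by (simp add: algebra_simps)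
    ultimately have k: "2 * s \<le> n" "octagon (n - 2 * s) (a - b) (a + b)" using in_level_iff by blast+
    \<comment> \<open>Both \<open>a - b\<close> and \<open>a + b\<close> are odd, so their absolute
      values add up to at least 2, too much for index 0.\<close>
    have "n \<noteq> 2 * s"
    proof
      assume "n = 2 * s"
      then have "\<bar>a - b\<bar> \<le> 1" "\<bar>a + b\<bar> \<le> 1" "\<bar>a - b\<bar> + \<bar>a + b\<bar> \<le> 1" using k(2) by (simp_all add: octagon_def)
      then show False using s(3) True by presburger
    qed
    then obtain j where j: "n = Suc j + 2 * s" using k(1) by (metis add.commute le_Suc_ex less_imp_Suc_add add_Suc le_neq_implies_less)
    have "octagon (Suc j) (a - b) (a + b)" using k(2) j by simp
    then have "max \<bar>a - b\<bar> \<bar>a + b\<bar> \<le> w (Suc j) - 2" "\<bar>a - b\<bar> + \<bar>a + b\<bar> \<le> 2 * w j - 3"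
      unfolding octagon_def by simp_all
    then have "\<bar>a\<bar> + \<bar>b\<bar> \<le> w (Suc j) - 2" "max \<bar>a\<bar> \<bar>b\<bar> \<le> w j - 2"
      unfolding abs_sum_diff by linarith+
    moreover have "\<bar>a\<bar> + \<bar>b\<bar> \<noteq> w (Suc j) - 2"
    proof -
      have "even (w (Suc j) - 2)" using even_w_Suc[of j] by simp
      moreover have "odd (\<bar>a\<bar> + \<bar>b\<bar>)" using True by simp
      ultimately show ?thesis by metis
    qed
    ultimately have "\<bar>a\<bar> + \<bar>b\<bar> \<le> w (Suc j) - 3" "max \<bar>a\<bar> \<bar>b\<bar> \<le> w j - 2" by simp_all
    then have "octagon j a b" unfolding octagon_def by simp
    then show ?thesis using in_level_iff[OF s(3), of "n - 1" s] s(1,2) j by simp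
  next
    case False
    define a' b' where "a' = (a - b) div 2" and "b' = (a + b) div 2"
    have ab: "a - b = 2 * a'" "a + b = 2 * b'" using False by (simp_all add: a'_def b'_def)
    have ab': "odd a' \<or> odd b'" using ab s(3) False by presburger
    have "x - y = 2 ^ Suc s * a'" "x + y = 2 ^ Suc s * b'"
      using ab s(1,2) by (simp_all flip: right_diff_distrib distrib_left)
    then have k: "2 * Suc s \<le> n" "octagon (n - 2 * Suc s) a' b'"
      using in_level_iff[OF ab'] assms by metis+
    define j where "j = n - 2 * Suc s"
    have n: "n = j + 2 + 2 * s" using k(1) by (simp add: j_def)
    have "max \<bar>a'\<bar> \<bar>b'\<bar> \<le> w j - 2" "\<bar>a'\<bar> + \<bar>b'\<bar> \<le> w (Suc j) - 3"
      using k(2) unfolding octagon_def j_def[symmetric] by simp_all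
    then have "\<bar>a\<bar> + \<bar>b\<bar> \<le> 2 * w j - 4" "max \<bar>a\<bar> \<bar>b\<bar> \<le> w (Suc j) - 3"
      unfolding abs_half_sum_diff[OF ab] by linarith+
    then have "octagon (Suc j) a b" unfolding octagon_def by simp
    then show ?thesis using in_level_iff[OF s(3), of "n - 1" s] s(1,2) n by simp
  qed
qed

text \<open>The converse of \<open>in_level_rotate_scaleD\<close>, by the same distinction. Now
  parity helps when \<open>a\<close> and \<open>b\<close> are both odd: they cannot attain the even
  bound \<open>w j - 2\<close>.\<close>

lemma in_level_rotate_scale:
  assumes "in_level n x y"
  shows "in_level (Suc n) (x - y) (x + y)"
proof -
  obtain s a b where s: "x = 2 ^ s * a" "y = 2 ^ s * b" "odd a \<or> odd b"
    and k: "2 * s \<le> n" "octagon (n - 2 * s) a b"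
    using assms unfolding in_level_def by blast
  define j where "j = n - 2 * s"
  have n: "n = j + 2 * s" using k by (simp add: j_def)
  show ?thesis
  proof (cases "odd (a + b)")
    case True
    then have o: "odd (a - b) \<or> odd (a + b)" by simp
    have "\<bar>a\<bar> + \<bar>b\<bar> \<le> w (Suc j) - 3" "max \<bar>a\<bar> \<bar>b\<bar> \<le> w j - 2"
      using k(2) unfolding octagon_def j_def[symmetric] by simp_all
    then have "max \<bar>a - b\<bar> \<bar>a + b\<bar> \<le> w (Suc j) - 3" "\<bar>a - b\<bar> + \<bar>a + b\<bar> \<le> 2 * w j - 4"
      unfolding abs_sum_diff by linarith+
    then have "octagon (Suc j) (a - b) (a + b)" unfolding octagon_def by simp
    moreover have "Suc n - 2 * s = Suc j" using n by simp
    ultimately have "in_level (Suc n) (2 ^ s * (a - b)) (2 ^ s * (a + b))"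
      unfolding in_level_iff[OF o] using k(1) by simp
    then show ?thesis using s by (simp add: algebra_simps)
  next
    case False
    define a' b' where "a' = (a - b) div 2" and "b' = (a + b) div 2"
    have ab: "a - b = 2 * a'" "a + b = 2 * b'" using False by (simp_all add: a'_def b'_def)
    have ab': "odd a' \<or> odd b'" using ab s(3) False by presburger
    have xy: "x - y = 2 ^ Suc s * a'" "x + y = 2 ^ Suc s * b'"
      using ab s(1,2) by (simp_all flip: right_diff_distrib distrib_left)
    have odd: "odd a" "odd b" using s(3) False by auto
    have "j \<noteq> 0"
    proof
      assume "j = 0"
      then have "\<bar>a\<bar> + \<bar>b\<bar> \<le> 1" using k(2) by (simp add: octagon_def j_def[symmetric])
      then show False using odd by presburger
    qed
    then obtain i where i: "j = Suc i" by (cases j) auto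
    have "even (w j)" unfolding i by (rule even_w_Suc)
    then have "\<bar>a\<bar> \<noteq> w j - 2" "\<bar>b\<bar> \<noteq> w j - 2" using odd by presburger+
    moreover have "max \<bar>a\<bar> \<bar>b\<bar> \<le> w j - 2" "\<bar>a\<bar> + \<bar>b\<bar> \<le> w (Suc j) - 3"
      using k(2) unfolding octagon_def j_def[symmetric] by simp_all
    ultimately have "max \<bar>a\<bar> \<bar>b\<bar> \<le> w j - 3" "\<bar>a\<bar> + \<bar>b\<bar> \<le> w (Suc j) - 3"
      by (auto simp: max_def split: if_splits)
    then have "\<bar>a'\<bar> + \<bar>b'\<bar> \<le> w (Suc i) - 3" "2 * max \<bar>a'\<bar> \<bar>b'\<bar> \<le> 2 * w i - 3"
      unfolding abs_half_sum_diff[OF ab] i by simp_all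
    \<comment> \<open>Integrality rounds \<open>2 * max <= 2 * w i - 3\<close> down to
      \<open>max <= w i - 2\<close>.\<close>
    then have "octagon i a' b'" unfolding octagon_def by linarith
    moreover have "Suc n - 2 * Suc s = i" "2 * Suc s \<le> Suc n" using n i by simp_all
    ultimately show ?thesis unfolding xy in_level_iff[OF ab'] by simp
  qed
qed

lemma unit_correction_in_gauss_ints:
  assumes "b \<noteq> 0" "r \<noteq> 0"
  shows "unit_of b / unit_of r \<in> gauss_ints" "\<i> * unit_of b / (s_sign r * unit_of r) \<in> gauss_ints"
proof -
  have "unit_of b \<in> gauss_units" "unit_of r \<in> gauss_units"
    using is_unit_of_unit_of[OF assms(1)] is_unit_of_unit_of[OF assms(2)] by (simp_all add: is_unit_of_def)
  then have "unit_of b / unit_of r \<in> gauss_units" by (rule gauss_units_divide)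
  then show *: "unit_of b / unit_of r \<in> gauss_ints" by (rule gauss_units_facts)
  \<comment> \<open>Sign 0 is harmless: division by zero yields 0, again a Gaussian integer.\<close>
  have "s_sign r = 1 \<or> s_sign r = -1 \<or> s_sign r = 0"
    by (simp add: s_sign_def sgn_if)
  moreover have i: "\<i> \<in> gauss_ints" "- \<i> \<in> gauss_ints" by (simp_all add: gauss_ints_def)
  note this[THEN gauss_ints_closed(3), OF *]
  moreover have "0 \<in> gauss_ints" by (simp add: gauss_ints_def)
  ultimately show "\<i> * unit_of b / (s_sign r * unit_of r) \<in> gauss_ints"
    by (elim disjE) (simp_all add: i)
qed

subsection \<open>The minimal Euclidean function\<close>

definition min_level :: "complex \<Rightarrow> nat" where
  "min_level z = (LEAST n. level n z)"

lemma level_min_level: "z \<in> gauss_ints - {0} \<Longrightarrow> level (min_level z) z"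
  unfolding min_level_def by (rule LeastI_ex) (rule level_exists)

lemma min_level_le: "level n z \<Longrightarrow> min_level z \<le> n"
  unfolding min_level_def by (rule Least_le)

text \<open>Gauss division either lowers the level already, or \<open>remainder_step\<close>
  supplies a correction \<open>d\<close> of the quotient that does.\<close>

lemma euclidean_fun_min_level: "euclidean_fun min_level"
  unfolding euclidean_fun_def
proof (intro ballI)
  fix a b assume a: "a \<in> gauss_ints - {0}" and b: "b \<in> gauss_ints - {0}"
  define q r n where "q = gauss_quot a b" and "r = gauss_rem a b" and "n = min_level b"
  have q: "q \<in> gauss_ints" and r: "r \<in> gauss_ints"
    using a b gauss_quot_rem_ints unfolding q_def r_def by blast+
  have abr: "a = q * b + r" by (simp add: q_def r_def gauss_rem_def)
  show "\<exists>q\<in>gauss_ints. \<exists>r\<in>gauss_ints. a = q * b + r \<and> (r = 0 \<or> min_level r < min_level b)"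
  proof (cases "r = 0 \<or> min_level r < n")
    case True
    then show ?thesis using q r abr unfolding n_def by blast
  next
    case False
    obtain t where t: "r = t * b" "\<bar>Re t\<bar> \<le> 1 / 2" "\<bar>Im t\<bar> \<le> 1 / 2"
      using gauss_remainder_bounds b unfolding r_def by blast
    have n: "level n b" "n = 0 \<or> \<not> level (n - 1) r"
      using level_min_level[OF b] min_level_le[of "n - 1" r] False unfolding n_def[symmetric] by auto
    have r': "r \<in> gauss_ints - {0}" using r False by blast
    note step = remainder_step[OF b r' t n]
    have "\<exists>d \<in> gauss_ints. level (n - 1) (r - d * b)"
      using step(2,3) unit_correction_in_gauss_ints[of b r] b r' by blast
    then obtain d where d: "d \<in> gauss_ints" "level (n - 1) (r - d * b)" by blast
    have "min_level (r - d * b) < n" using min_level_le[OF d(2)] step(1) by linarith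
    moreover have "a = (q + d) * b + (r - d * b)" unfolding abr by (simp add: algebra_simps)
    moreover have "q + d \<in> gauss_ints" "r - d * b \<in> gauss_ints"
      using q d level_nonzero gauss_ints_closed by blast+
    ultimately show ?thesis unfolding n_def by blast
  qed
qed

text \<open>The lower bound for Euclidean functions. In coordinates, the hypothesis says that every
  class modulo z = x + y i contains 0 or a point of level \<open>n - 1\<close>; e + f i is the
  quotient.\<close>

lemma in_level_of_covering:
  assumes "\<And>a b. \<exists>e f. a - (e * x - f * y) = 0 \<and> b - (e * y + f * x) = 0
      \<or> 0 < n \<and> in_level (n - 1) (a - (e * x - f * y)) (b - (e * y + f * x))"
  shows "in_level n x y"
  using assms
proof (induction n arbitrary: x y)
  \<comment> \<open>Only 0 may represent the class of 1, so z divides 1 and has norm 1.\<close>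
  case 0
  obtain e f where ef: "e * x - f * y = 1" "e * y + f * x = 0"
    using 0[of 1 0] by auto
  have "(e\<^sup>2 + f\<^sup>2) * (x\<^sup>2 + y\<^sup>2) = (e * x - f * y)\<^sup>2 + (e * y + f * x)\<^sup>2"
    by (simp add: power2_eq_square algebra_simps)
  then have "(e\<^sup>2 + f\<^sup>2) * (x\<^sup>2 + y\<^sup>2) = 1" unfolding ef by simp
  then have N: "x\<^sup>2 + y\<^sup>2 = 1"
    by (metis add_nonneg_nonneg zero_le_power2 zmult_eq_1_iff abs_of_nonneg abs_minus_cancel abs_1 mult.commute)
  then have "x = 0 \<and> \<bar>y\<bar> = 1 \<or> \<bar>x\<bar> = 1 \<and> y = 0"
  proof (cases "x = 0")
    case False
    then have "1 \<le> x\<^sup>2" by (simp add: int_one_le_iff_zero_less)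
    then have "y\<^sup>2 = 0" "x\<^sup>2 = 1" using N zero_le_power2[of y] by linarith+
    then show ?thesis by (simp add: power2_eq_1_iff abs_eq_iff')
  qed (simp add: power2_eq_1_iff abs_eq_iff')
  moreover from this have "odd x \<or> odd y" by presburger
  ultimately show ?case unfolding in_level_odd[OF \<open>odd x \<or> odd y\<close>] octagon_def by auto
next
  case (Suc m)
  note covered = Suc.prems[unfolded diff_Suc_1]
  show ?case
  proof (cases "odd (x + y)")
    case True
    obtain e f where ef: "(x - y + 1) div 2 - (e * x - f * y) = 0 \<and> (x + y + 1) div 2 - (e * y + f * x) = 0
       \<or> in_level m ((x - y + 1) div 2 - (e * x - f * y)) ((x + y + 1) div 2 - (e * y + f * x))"
      using covered[of "(x - y + 1) div 2" "(x + y + 1) div 2"] by blast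
    \<comment> \<open>The representative may be 0, which has no level but lies in every
      octagon.\<close>
    have "octagon m 0 0" using w_ge[of m] w_ge[of "Suc m"] by (simp add: octagon_def)
    then have "octagon m ((x - y + 1) div 2 - (e * x - f * y)) ((x + y + 1) div 2 - (e * y + f * x))"
      using ef in_level_octagon by (elim disjE conjE) (simp_all only:)
    then have "octagon (Suc m) x y" by (rule octagon_of_deep_hole[OF True])
    moreover have "odd x \<or> odd y" using True by auto
    ultimately show ?thesis using in_level_odd by blast
  next
    case False
    \<comment> \<open>Here z = (1 + i) z' with z' = x' + y' i. Representatives of the classes of (1
      + i) (a + b i) modulo z are divisible by 1 + i, and cancelling this factor lowers their level
      by one.\<close>
    define x' y' where "x' = (x + y) div 2" and "y' = (y - x) div 2"
    have xy: "x = x' - y'" "y = x' + y'" using False unfolding x'_def y'_def by presburger+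
    have "in_level m x' y'"
    proof (rule Suc.IH)
      fix a b
      obtain e f where ef: "(a - b) - (e * x - f * y) = 0 \<and> (a + b) - (e * y + f * x) = 0
         \<or> in_level m ((a - b) - (e * x - f * y)) ((a + b) - (e * y + f * x))"
        using covered[of "a - b" "a + b"] by blast
      define A B where "A = a - (e * x' - f * y')" and "B = b - (e * y' + f * x')"
      have "(a - b) - (e * x - f * y) = A - B" "(a + b) - (e * y + f * x) = A + B"
        unfolding A_def B_def xy by (simp_all add: algebra_simps)
      then have "A - B = 0 \<and> A + B = 0 \<or> in_level m (A - B) (A + B)" using ef by simp
      then have "A = 0 \<and> B = 0 \<or> 0 < m \<and> in_level (m - 1) A B"
        using in_level_rotate_scaleD by auto
      then show "\<exists>e f. a - (e * x' - f * y') = 0 \<and> b - (e * y' + f * x') = 0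
        \<or> 0 < m \<and> in_level (m - 1) (a - (e * x' - f * y')) (b - (e * y' + f * x'))"
        unfolding A_def B_def by blast
    qed
    then show ?thesis unfolding xy by (rule in_level_rotate_scale)
  qed
qed

text \<open>By induction, remainders of smaller value have level at most \<open>f z - 1\<close>, so
  the division property of \<open>f\<close> at \<open>z\<close> is the hypothesis of
  \<open>in_level_of_covering\<close>.\<close>

lemma level_of_euclidean_fun:
  fixes f :: "complex \<Rightarrow> nat"
  assumes f: "euclidean_fun f" and "z \<in> gauss_ints - {0}"
  shows "level (f z) z"
  using assms(2)
proof (induction "f z" arbitrary: z rule: less_induct)
  case less
  obtain x y where z: "z = Complex (of_int x) (of_int y)" using less.prems gauss_ints_Complex by blast
  have "in_level (f z) x y"
  proof (rule in_level_of_covering)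
    fix a b
    show "\<exists>e h. a - (e * x - h * y) = 0 \<and> b - (e * y + h * x) = 0
      \<or> 0 < f z \<and> in_level (f z - 1) (a - (e * x - h * y)) (b - (e * y + h * x))"
    proof (cases "a = 0 \<and> b = 0")
      case True
      then show ?thesis by (intro exI[of _ 0]) simp
    next
      case False
      define c where "c = Complex (of_int a) (of_int b)"
      have "c \<in> gauss_ints - {0}" using False gauss_ints_Complex by (auto simp: c_def complex_eq_iff)
      then obtain q r where qr: "q \<in> gauss_ints" "r \<in> gauss_ints" "c = q * z + r" "r = 0 \<or> f r < f z"
        using f less.prems unfolding euclidean_fun_def by blast
      obtain e h where q: "q = Complex (of_int e) (of_int h)" using qr(1) gauss_ints_Complex by blast
      have "r = c - q * z" using qr(3) by simp
      then have r: "r = Complex (of_int (a - (e * x - h * y))) (of_int (b - (e * y + h * x)))"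
        unfolding c_def q z by (simp add: complex_eq_iff)
      show ?thesis
      proof (cases "r = 0")
        case True
        then show ?thesis unfolding r zero_complex.code complex.inject of_int_eq_0_iff by blast
      next
        case False
        then have "f r < f z" "level (f r) r" using qr(2,4) less.hyps by auto
        then have "0 < f z" "level (f z - 1) r" using level_mono[of "f r" r "f z - 1"] by auto
        then show ?thesis unfolding r level_Complex by blast
      qed
    qed
  qed
  then show ?case unfolding z by simp
qed

lemma level_iff_min_euclid_le:
  assumes "z \<in> gauss_ints - {0}"
  shows "level n z \<longleftrightarrow> min_euclid z \<le> n"
proof
  assume "level n z"
  then show "min_euclid z \<le> n"
    using min_level_le min_euclid_le[OF euclidean_fun_min_level, of z] by (meson le_trans)
next
  assume "min_euclid z \<le> n"
  then show "level n z"
    using level_of_euclidean_fun[OF euclidean_fun_min_euclid assms] level_mono by blast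
qed

theorem theorem2:
  fixes a b q r :: complex and n :: nat
  assumes "a \<in> gauss_ints - {0}" and "b \<in> gauss_ints - {0}"
    and "q = gauss_quot a b" and "r = gauss_rem a b" and "r \<noteq> 0"
    and "min_euclid r \<ge> min_euclid b" and "min_euclid b = n"
  shows
    "if Im (unit_of b * b) * Im (unit_of r * r) \<ge> 0
        \<or> lmin r + lmin b \<le> linf r
        \<or> (lmin b < linf r \<and> linf r < lmin b + lmin r
            \<and> linf b - lmin r > w_seq (int n - 1) - 2 ^ (v2 b + 1))
     then
       q + unit_of b / unit_of r \<in> gauss_ints
        \<and> a = (q + unit_of b / unit_of r) * b + (r - unit_of b / unit_of r * b)
        \<and> r - unit_of b / unit_of r * b \<in> gauss_ints - {0}
        \<and> min_euclid (r - unit_of b / unit_of r * b) < min_euclid b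
     else
       q + \<i> * unit_of b / (s_sign r * unit_of r) \<in> gauss_ints
        \<and> a = (q + \<i> * unit_of b / (s_sign r * unit_of r)) * b
              + (r - \<i> * unit_of b / (s_sign r * unit_of r) * b)
        \<and> r - \<i> * unit_of b / (s_sign r * unit_of r) * b \<in> gauss_ints - {0}
        \<and> min_euclid (r - \<i> * unit_of b / (s_sign r * unit_of r) * b) < min_euclid b"
proof -
  have q: "q \<in> gauss_ints" and r: "r \<in> gauss_ints - {0}"
    using assms gauss_quot_rem_ints by blast+
  have abr: "a = q * b + r" by (simp add: assms(3,4) gauss_rem_def)
  obtain t where t: "r = t * b" "\<bar>Re t\<bar> \<le> 1 / 2" "\<bar>Im t\<bar> \<le> 1 / 2"
    using gauss_remainder_bounds assms(2,4) by blast
  \<comment> \<open>The assumption on \<open>min_euclid r\<close> becomes failure of level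
    \<open>n - 1\<close>; \<open>n = 0\<close> is kept apart because natural subtraction
    truncates.\<close>
  have n: "level n b" "n = 0 \<or> \<not> level (n - 1) r"
    using level_iff_min_euclid_le[OF assms(2)] level_iff_min_euclid_le[OF r] assms(6,7) by auto
  note step = remainder_step[OF assms(2) r t n]
  have concl: "q + d \<in> gauss_ints \<and> a = (q + d) * b + (r - d * b)
      \<and> r - d * b \<in> gauss_ints - {0} \<and> min_euclid (r - d * b) < min_euclid b"
    if d: "d \<in> gauss_ints" "level (n - 1) (r - d * b)" for d
  proof -
    have "r - d * b \<in> gauss_ints - {0}" using d(2) by (rule level_nonzero)
    moreover from this have "min_euclid (r - d * b) \<le> n - 1" using level_iff_min_euclid_le d(2) by blast
    moreover have "q + d \<in> gauss_ints" using q d(1) by (rule gauss_ints_closed)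
    moreover have "a = (q + d) * b + (r - d * b)" unfolding abr by (simp add: algebra_simps)
    ultimately show ?thesis using step(1) assms(7) by linarith
  qed
  have "b \<noteq> 0" using assms(2) by simp
  note d = unit_correction_in_gauss_ints[OF this assms(5)]
  show ?thesis
    by (split if_split)
      (rule conjI; rule impI, (rule concl[OF d(1) step(2)] | rule concl[OF d(2) step(3)]); assumption)
qed

end
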